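(* Let $M\ge2$ be an integer, let $S_1,\dots,S_M:\mathbb R^d\to\mathbb R^d$ be contracting similarities with respective Lipschitz constants $r_1,\dots,r_M\in(0,1)$, and let $(p_1,\dots,p_M)$ be a probability vector with all $p_m>0$. Let $K$ be the unique nonempty compact subset of $\mathbb R^d$ such that $K=\bigcup_{m}S_m(K)$ and let $\pi$ be the unique Borel probability measure on $\mathbb R^d$ such that $\pi=\sum_m p_m\,\pi\circ S_m^{-1}$. Assume that the Open Set Condition is satisfied, and let $$s_{\min}=\min_m\frac{\log p_m}{\log r_m},\qquad s_{\max}=\max_m\frac{\log p_m}{\log r_m}.$$ Then a typical measure $\mu\in\mathcal P(K)$ satisfies $$\underline{\dim}^{q}_{*,\pi,B}(\mu)=\underline{\dim}^{*,q}_{\pi,B}(\mu)=\begin{cases}-s_{\max}\,q&\text{for any } q\ge0,\\ -s_{\min}\,q&\text{for any } q\le0.\end{cases}$$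
   Context: The Open Set Condition for $(S_1,\dots,S_M)$: there is a nonempty bounded open set $U\subset\mathbb R^d$ with $S_m U\subset U$ for all $m$ and $S_mU\cap S_lU=\varnothing$ for all $l\ne m$. It is well known that $\operatorname{supp}\pi=K$. $\mathcal P(K)$ is the set of Borel probability measures on $K$, endowed with the weak topology. A property holds for a typical measure of $\mathcal P(K)$ if it is satisfied by all elements of some dense $G_\delta$ subset of $\mathcal P(K)$. $B(x,r)$ is the open ball of centre $x$ and radius $r$ in $\mathbb R^d$. For $E\subset K$, $r>0$ and $q\in\mathbb R$ let $$\mathbf N_\pi^q(E,r)=\inf\sum_i\pi\big(B(x_i,r)\big)^q,$$ the infimum being over all at most countable families of balls $(B(x_i,r))_i$ with centres $x_i\in K$ covering $E$. The lower covering multifractal box dimension of $E$ of order $q$ with respect to $\pi$ is $$\underline{\dim}_{\pi,B}^q(E)=\liminf_{r\to0^+}\frac{\log\mathbf N_\pi^q(E,r)}{-\log r}.$$ For $\mu\in\mathcal P(K)$, the small and big lower multifractal box dimensions of $\mu$ of order $q$ with respect to $\pi$ are $$\underline{\dim}^{q}_{*,\pi,B}(\mu)=\inf_{\mu(E)>0}\underline{\dim}_{\pi,B}^q(E),\qquad \underline{\dim}^{*,q}_{\pi,B}(\mu)=\lim_{\varepsilon\to0^+}\inf_{\mu(E)>1-\varepsilon}\underline{\dim}_{\pi,B}^q(E),$$ where $E$ ranges over Borel subsets of $K$. *)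

theory Defs
  imports "HOL-Probability.Probability"
begin

definition contracting_similarity :: "real \<Rightarrow> ('a::metric_space \<Rightarrow> 'a) \<Rightarrow> bool"
  where "contracting_similarity c f \<longleftrightarrow>
    0 < c \<and> c < 1 \<and> (\<forall>x y. dist (f x) (f y) = c * dist x y)"

definition open_set_condition :: "nat \<Rightarrow> (nat \<Rightarrow> 'a::metric_space \<Rightarrow> 'a) \<Rightarrow> bool"
  where "open_set_condition M S \<longleftrightarrow>
    (\<exists>U. U \<noteq> {} \<and> bounded U \<and> open U \<and>
         (\<forall>m\<in>{1..M}. S m ` U \<subseteq> U) \<and>
         (\<forall>l\<in>{1..M}. \<forall>m\<in>{1..M}. l \<noteq> m \<longrightarrow> S l ` U \<inter> S m ` U = {}))"

(* These measures have space K and sigma-algebra the Borel subsets of K. *)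
definition prob_measures_on :: "'a::topological_space set \<Rightarrow> 'a measure set"
  where "prob_measures_on K = {\<mu>. prob_space \<mu> \<and> sets \<mu> = sets (restrict_space borel K)}"

(* The coarsest topology making every map sending \<mu> to the integral of f against \<mu>,
   with f bounded and continuous on K, continuous. *)
definition weak_topology_on :: "'a::topological_space set \<Rightarrow> 'a measure topology"
  where "weak_topology_on K = topology_generated_by
    {{\<mu> \<in> prob_measures_on K. integral\<^sup>L \<mu> f \<in> V} | f V.
       continuous_on K f \<and> bounded (f ` K) \<and> open (V :: real set)}"

definition typically :: "'b topology \<Rightarrow> ('b \<Rightarrow> bool) \<Rightarrow> bool"
  where "typically X P \<longleftrightarrow>
    (\<exists>D. gdelta_in X D \<and> X closure_of D = topspace X \<and> (\<forall>x\<in>D. P x))"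

(* The library's ln is totalised with ln 0 = 0, hence the explicit endpoint values. *)
definition log_ext :: "ennreal \<Rightarrow> ereal"
  where "log_ext x = (if x = 0 then -\<infinity> else if x = \<infinity> then \<infinity> else ereal (ln (enn2real x)))"

(* An at most countable family of balls is indexed by a set I of naturals (finite or infinite).
   The sums may be infinite. For q <= 0 the convention 0 powr q = 0 is never used when K is
   the support of \<pi>, since balls centred in K then have positive measure. *)
definition covering_number :: "'a::metric_space set \<Rightarrow> 'a measure \<Rightarrow> real \<Rightarrow> 'a set \<Rightarrow> real \<Rightarrow> ennreal"
  where "covering_number K \<pi> q E r =
    (INF (I, x) \<in> {(I :: nat set, x). x ` I \<subseteq> K \<and> E \<subseteq> (\<Union>i\<in>I. ball (x i) r)}.
       \<Sum>\<^sub>\<infinity>i\<in>I. ennreal (measure \<pi> (ball (x i) r) powr q))"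

definition lower_box_dim :: "'a::metric_space set \<Rightarrow> 'a measure \<Rightarrow> real \<Rightarrow> 'a set \<Rightarrow> ereal"
  where "lower_box_dim K \<pi> q E =
    Liminf (at_right 0) (\<lambda>r. log_ext (covering_number K \<pi> q E r) / ereal (- ln r))"

(* For \<mu> in prob_measures_on K, the members of sets \<mu> are exactly the Borel subsets of K. *)
definition small_lower_box_dim :: "'a::metric_space set \<Rightarrow> 'a measure \<Rightarrow> real \<Rightarrow> 'a measure \<Rightarrow> ereal"
  where "small_lower_box_dim K \<pi> q \<mu> =
    (INF E \<in> {E \<in> sets \<mu>. measure \<mu> E > 0}. lower_box_dim K \<pi> q E)"

definition big_lower_box_dim :: "'a::metric_space set \<Rightarrow> 'a measure \<Rightarrow> real \<Rightarrow> 'a measure \<Rightarrow> ereal"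
  where "big_lower_box_dim K \<pi> q \<mu> =
    Lim (at_right 0) (\<lambda>\<epsilon>. INF E \<in> {E \<in> sets \<mu>. measure \<mu> E > 1 - \<epsilon>}. lower_box_dim K \<pi> q E)"

end

theory Submission
  imports Defs
begin

text \<open>
  Both values are forced by the mass that \<open>\<pi>\<close> gives to small balls centred in \<open>K\<close>. Every such ball
  has mass at least a constant times \<open>\<rho> powr smax\<close>, because it contains a cylinder of comparable size,
  and at most a constant times \<open>\<rho> powr smin\<close>, because the open set condition lets it meet only boundedly
  many cylinders of comparable size (\<open>ex_measure_ball_ge\<close>, \<open>ex_measure_ball_le\<close>). A covering of
  a nonempty set contains at least one ball, so one summand alone already gives the lower bounds
  \<open>- smax * q\<close> for \<open>q \<ge> 0\<close> and \<open>- smin * q\<close> for \<open>q \<le> 0\<close>.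

  The upper bounds ask for a set of almost full \<open>\<mu>\<close>-measure that, for every tolerance \<open>t > 0\<close> and at
  arbitrarily small scales \<open>\<rho>\<close>, is covered by at most \<open>\<rho> powr (- t)\<close> balls, all of them thin (mass at most
  \<open>\<rho> powr (smax - t)\<close>), and at other such scales by as few balls, all of them fat (mass at
  least \<open>\<rho> powr (smin + t)\<close>). A finitely supported measure has this property when each of its atoms
  has thin balls, and fat balls, at arbitrarily small scales common to all the atoms. If a continuous
  \<open>f\<close> is at most the indicator of the union of the covering balls, then \<open>integral\<^sup>L \<mu> f > 1 - \<epsilon>\<close> is an
  open condition on \<open>\<mu>\<close> that forces the union to have measure above \<open>1 - \<epsilon>\<close>. Requiring such an
  \<open>f\<close> for each of countably many tolerances defines a \<open>G\<^sub>\<delta>\<close> set of measures; it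
  contains the finitely supported measures above, which are dense as soon as their possible atoms are
  dense in \<open>K\<close> (\<open>typically_finitely_coverable\<close>).

  The atoms are the images of one point \<open>x\<close> under all compositions of the similarities. The address of
  \<open>x\<close> contains longer and longer runs of a letter realising \<open>smax\<close> and of a letter realising \<open>smin\<close>. A
  run of the latter makes a cylinder, hence a ball, of large mass. For a run of the former one must
  prevent the ball from meeting heavier cylinders next to it. This is Schief's idea: a word \<open>w\<close> whose
  cylinder has as many neighbours as possible keeps exactly these neighbours under every prefix \<open>u\<close>, so
  a ball around the cylinder of \<open>u @ w\<close> of that cylinder's size has mass at most
  \<open>weight u\<close> (\<open>ex_isolated_word\<close>). Ending the run with \<open>w\<close> therefore makes the ball thin.
\<close>


section \<open>Typical measures in the weak topology\<close>

lemma topspace_weak_topology_on: "topspace (weak_topology_on K) = prob_measures_on K"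
proof -
  have "prob_measures_on K \<in> {{\<mu> \<in> prob_measures_on K. integral\<^sup>L \<mu> f \<in> V} | f V.
       continuous_on K f \<and> bounded (f ` K) \<and> open (V :: real set)}"
    by (intro CollectI exI[of _ "\<lambda>_. 0"] exI[of _ UNIV]) (auto intro: boundedI)
  then show ?thesis
    unfolding weak_topology_on_def topology_generated_by_topspace by blast
qed

lemma openin_integral_greater:
  fixes f :: "'a::topological_space \<Rightarrow> real"
  assumes "continuous_on K f" "bounded (f ` K)"
  shows "openin (weak_topology_on K) {\<mu> \<in> prob_measures_on K. c < integral\<^sup>L \<mu> f}"
  unfolding weak_topology_on_def
  by (rule topology_generated_by_Basis)
    (use assms in \<open>intro CollectI exI[of _ f] exI[of _ "{c<..}"] conjI; simp\<close>)

text \<open>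
  The topology is given by a subbasis, so this is proved by induction on its generation; it exhibits
  the familiar neighbourhood basis given by finitely many integrals.
\<close>
lemma weak_neighbourhood:
  fixes K :: "'a::topological_space set"
  assumes "openin (weak_topology_on K) T" "\<mu> \<in> T"
  shows "\<exists>L :: ('a \<Rightarrow> real) set. \<exists>e. finite L \<and> 0 < e \<and> (\<forall>f\<in>L. continuous_on K f \<and> bounded (f ` K)) \<and>
     (\<forall>\<nu>\<in>prob_measures_on K. (\<forall>f\<in>L. \<bar>integral\<^sup>L \<nu> f - integral\<^sup>L \<mu> f\<bar> < e) \<longrightarrow> \<nu> \<in> T)"
proof -
  have "generate_topology_on {{\<mu> \<in> prob_measures_on K. integral\<^sup>L \<mu> f \<in> V} | f V.
       continuous_on K f \<and> bounded (f ` K) \<and> open (V :: real set)} T"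
    using assms(1) unfolding weak_topology_on_def by (rule openin_topology_generated_by)
  then show ?thesis
    using assms(2)
  proof induction
    case Empty
    then show ?case by simp
  next
    case (Int a b)
    from Int.prems have "\<mu> \<in> a" "\<mu> \<in> b" by auto
    then obtain L L' :: "('a \<Rightarrow> real) set" and e e' where
      "finite L \<and> 0 < e \<and> (\<forall>f\<in>L. continuous_on K f \<and> bounded (f ` K)) \<and>
      (\<forall>\<nu>\<in>prob_measures_on K. (\<forall>f\<in>L. \<bar>integral\<^sup>L \<nu> f - integral\<^sup>L \<mu> f\<bar> < e) \<longrightarrow> \<nu> \<in> a)"
      "finite L' \<and> 0 < e' \<and> (\<forall>f\<in>L'. continuous_on K f \<and> bounded (f ` K)) \<and>
      (\<forall>\<nu>\<in>prob_measures_on K. (\<forall>f\<in>L'. \<bar>integral\<^sup>L \<nu> f - integral\<^sup>L \<mu> f\<bar> < e') \<longrightarrow> \<nu> \<in> b)"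
      using Int.IH by presburger
    then show ?case
      by (intro exI[of _ "L \<union> L'"] exI[of _ "min e e'"]) auto
  next
    case (UN \<K>)
    then obtain k where k: "k \<in> \<K>" "\<mu> \<in> k" by blast
    from UN.IH[OF this] k(1) show ?case by (meson UnionI)
  next
    case (Basis s)
    then obtain f V where fV: "continuous_on K f" "bounded (f ` K)" "open (V :: real set)"
      and s: "s = {\<mu> \<in> prob_measures_on K. integral\<^sup>L \<mu> f \<in> V}" by blast
    then obtain e where e: "0 < e" "\<And>y. dist y (integral\<^sup>L \<mu> f) < e \<Longrightarrow> y \<in> V"
      using Basis.prems by (auto simp: open_dist)
    then show ?case
      using fV s by (intro exI[of _ "{f}"] exI[of _ e]) (auto simp: dist_real_def)
  qed
qed

text \<open>
  Giving priority to the point inserted last among those within distance \<open>\<delta>\<close> makes the choice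
  measurable.
\<close>
lemma measurable_nearby_selection:
  fixes C :: "'a::metric_space set"
  assumes "finite C"
  shows "\<exists>h \<in> borel_measurable borel. \<forall>x \<in> (\<Union>c\<in>C. ball c \<delta>). h x \<in> C \<and> dist (h x) x < \<delta>"
  using assms
proof (induction C rule: finite_induct)
  case empty
  then show ?case by (intro bexI[of _ "\<lambda>_. undefined"]) auto
next
  case (insert c C)
  then obtain h where h: "h \<in> borel_measurable borel"
    "\<forall>x \<in> (\<Union>c\<in>C. ball c \<delta>). h x \<in> C \<and> dist (h x) x < \<delta>" by blast
  show ?case
  proof (intro bexI[of _ "\<lambda>x. if x \<in> ball c \<delta> then c else h x"])
    show "(\<lambda>x. if x \<in> ball c \<delta> then c else h x) \<in> borel_measurable borel"
      by (rule measurable_If_set) (use h(1) in auto)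
  qed (use h(2) in auto)
qed

lemma integrable_bounded_continuous:
  assumes "\<mu> \<in> prob_measures_on K" "continuous_on K f" "bounded (f ` K)"
  shows "integrable \<mu> (f :: _ \<Rightarrow> real)"
proof -
  have sets: "sets \<mu> = sets (restrict_space borel K)" and "prob_space \<mu>"
    using assms(1) by (auto simp: prob_measures_on_def)
  interpret prob_space \<mu> by fact
  have sp: "space \<mu> = K"
    using sets_eq_imp_space_eq[OF sets] by (simp add: space_restrict_space)
  obtain B where B: "\<And>x. x \<in> K \<Longrightarrow> norm (f x) \<le> B"
    using assms(3) by (auto simp: bounded_iff)
  have "f \<in> borel_measurable \<mu>"
    using borel_measurable_continuous_on_restrict[OF assms(2)] sets
    by (simp cong: measurable_cong_sets)
  then show ?thesis
    using B by (intro integrable_const_bound[where B=B] AE_I2) (auto simp: sp)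
qed

text \<open>
  Pushing \<open>\<mu>\<close> forward along a finitely valued map that moves points of \<open>K\<close> by less than \<open>\<delta>\<close>, with
  values in the dense set \<open>G\<close>, changes the integral of a uniformly continuous function only a little.
\<close>
lemma finitely_supported_dense:
  fixes K :: "'a::metric_space set"
  assumes "compact K" "G \<subseteq> K" "K \<subseteq> closure G"
  shows "weak_topology_on K closure_of {\<nu> \<in> prob_measures_on K. \<exists>F. finite F \<and> F \<subseteq> G \<and> (AE x in \<nu>. x \<in> F)}
    = topspace (weak_topology_on K)" (is "_ closure_of ?D = _")
proof (rule equalityI[OF closure_of_subset_topspace], rule subsetI)
  fix \<mu> assume \<mu>: "\<mu> \<in> topspace (weak_topology_on K)"
  show "\<mu> \<in> weak_topology_on K closure_of ?D"
    unfolding in_closure_of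
  proof (intro conjI allI impI, fact \<mu>, elim conjE)
    fix T assume T: "\<mu> \<in> T" "openin (weak_topology_on K) T"
    obtain L :: "('a \<Rightarrow> real) set" and e where L: "finite L" "0 < e" "\<forall>f\<in>L. continuous_on K f \<and> bounded (f ` K)"
      and LT: "\<forall>\<nu>\<in>prob_measures_on K. (\<forall>f\<in>L. \<bar>integral\<^sup>L \<nu> f - integral\<^sup>L \<mu> f\<bar> < e) \<longrightarrow> \<nu> \<in> T"
      using weak_neighbourhood[OF T(2,1)] by blast
    have \<mu>K: "\<mu> \<in> prob_measures_on K" using \<mu> by (simp add: topspace_weak_topology_on)
    then have sets: "sets \<mu> = sets (restrict_space borel K)" and "prob_space \<mu>"
      by (auto simp: prob_measures_on_def)
    interpret prob_space \<mu> by fact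
    have sp: "space \<mu> = K"
      using sets_eq_imp_space_eq[OF sets] by (simp add: space_restrict_space)
    have "\<exists>\<delta>>0. \<forall>f\<in>L. \<forall>x\<in>K. \<forall>y\<in>K. dist x y < \<delta> \<longrightarrow> \<bar>f x - f y\<bar> < e/2"
      using L(1,3)
    proof (induction L rule: finite_induct)
      case empty
      then show ?case by (auto intro: exI[of _ 1])
    next
      case (insert f L)
      then obtain \<delta> where "0 < \<delta>"
        "\<forall>f\<in>L. \<forall>x\<in>K. \<forall>y\<in>K. dist x y < \<delta> \<longrightarrow> \<bar>f x - f y\<bar> < e/2" by auto
      moreover have "uniformly_continuous_on K f"
        using insert.prems \<open>compact K\<close> by (auto intro: compact_uniformly_continuous)
      from this[unfolded uniformly_continuous_on_def, rule_format, of "e/2"] \<open>0 < e\<close>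
      obtain \<delta>' where "0 < \<delta>'" "\<forall>x\<in>K. \<forall>y\<in>K. dist y x < \<delta>' \<longrightarrow> dist (f y) (f x) < e/2"
        by auto
      then have "0 < \<delta>'" "\<forall>x\<in>K. \<forall>y\<in>K. dist x y < \<delta>' \<longrightarrow> \<bar>f x - f y\<bar> < e/2"
        by (simp_all add: dist_real_def)
      ultimately show ?case by (intro exI[of _ "min \<delta> \<delta>'"]) auto
    qed
    then obtain \<delta> where \<delta>: "0 < \<delta>" and
      "\<forall>f\<in>L. \<forall>x\<in>K. \<forall>y\<in>K. dist x y < \<delta> \<longrightarrow> \<bar>f x - f y\<bar> < e/2" by blast
    then have uc: "\<And>f x y. f \<in> L \<Longrightarrow> x \<in> K \<Longrightarrow> y \<in> K \<Longrightarrow> dist x y < \<delta> \<Longrightarrow> \<bar>f x - f y\<bar> < e/2"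
      by blast
    have "K \<subseteq> (\<Union>g\<in>G. ball g \<delta>)"
    proof
      fix x assume "x \<in> K"
      then show "x \<in> (\<Union>g\<in>G. ball g \<delta>)"
        using assms(3) \<delta> closure_approachable[of x G] by auto
    qed
    then obtain C where C: "C \<subseteq> G" "finite C" "K \<subseteq> (\<Union>c\<in>C. ball c \<delta>)"
      using compactE_image[OF \<open>compact K\<close>, of G "\<lambda>g. ball g \<delta>"] by auto
    obtain h where h: "h \<in> borel_measurable borel"
      and hC: "\<And>x. x \<in> K \<Longrightarrow> h x \<in> C" "\<And>x. x \<in> K \<Longrightarrow> dist (h x) x < \<delta>"
      using measurable_nearby_selection[OF C(2), of \<delta>] C(3) by blast
    have CK: "C \<subseteq> K" using C(1) assms(2) by blast
    have hm: "h \<in> measurable \<mu> (restrict_space borel K)"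
    proof (rule measurable_restrict_space2)
      show "h \<in> borel_measurable \<mu>"
        using measurable_restrict_space1[OF h, of K] sets by (simp cong: measurable_cong_sets)
    qed (use hC CK sp in auto)
    define \<nu> where "\<nu> = distr \<mu> (restrict_space borel K) h"
    have \<nu>K: "\<nu> \<in> prob_measures_on K"
      unfolding \<nu>_def prob_measures_on_def using prob_space_distr[OF hm] by simp
    have "C \<in> sets (restrict_space borel K)"
      using C(2) CK by (auto simp: sets_restrict_space borel_closed finite_imp_closed intro!: image_eqI[of _ _ C])
    then have "{x \<in> space (restrict_space borel K). x \<in> C} \<in> sets (restrict_space borel K)"
      using CK by (simp add: space_restrict_space Collect_conj_eq Int_absorb1 Int_absorb2 Int_commute)
    then have "AE x in \<nu>. x \<in> C"
      unfolding \<nu>_def by (subst AE_distr_iff[OF hm]) (use hC sp in auto)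
    then have "\<nu> \<in> ?D" using \<nu>K C by blast
    moreover have "\<nu> \<in> T"
    proof -
      have "\<bar>integral\<^sup>L \<nu> f - integral\<^sup>L \<mu> f\<bar> < e" if f: "f \<in> L" for f
      proof -
        have near: "\<bar>f (h x) - f x\<bar> \<le> e/2" if "x \<in> K" for x
          using uc[OF f, of "h x" x] hC[OF that] that CK by fastforce
        have fc: "continuous_on K f" "bounded (f ` K)" using f L(3) by auto
        have "integral\<^sup>L \<nu> f = (\<integral>x. f (h x) \<partial>\<mu>)"
          unfolding \<nu>_def
          by (rule integral_distr[OF hm borel_measurable_continuous_on_restrict[OF fc(1)]])
        moreover have "integrable \<mu> (\<lambda>x. f (h x))"
          using integrable_bounded_continuous[OF \<nu>K fc]
            integrable_distr[OF hm] unfolding \<nu>_def by blast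
        ultimately have "integral\<^sup>L \<nu> f - integral\<^sup>L \<mu> f = (\<integral>x. f (h x) - f x \<partial>\<mu>)"
          using integrable_bounded_continuous[OF \<mu>K fc] by simp
        also have "\<bar>\<dots>\<bar> \<le> (\<integral>x. \<bar>f (h x) - f x\<bar> \<partial>\<mu>)" by (rule integral_abs_bound)
        also have "\<dots> \<le> e/2"
          using near
          by (intro integral_le_const integrable_abs Bochner_Integration.integrable_diff
                AE_I2 \<open>integrable \<mu> (\<lambda>x. f (h x))\<close> integrable_bounded_continuous[OF \<mu>K fc])
             (auto simp: sp)
        finally show ?thesis using \<open>0 < e\<close> by simp
      qed
      then show ?thesis using LT \<nu>K by blast
    qed
    ultimately show "\<exists>y. y \<in> ?D \<and> y \<in> T" by blast
  qed
qed

lemma typically_mono: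
  assumes "typically X P" "\<And>x. P x \<Longrightarrow> Q x"
  shows "typically X Q"
  using assms unfolding typically_def by blast

text \<open>
  A criterion for typical behaviour: if every finite subset of a dense set \<open>G\<close> satisfies each of
  countably many conditions \<open>R k\<close> at some scale, then the balls of that scale around such finite
  sets cover, up to measure \<open>\<eta>\<close> and for all \<open>k\<close> simultaneously, the mass of a typical measure.
  The sets \<open>V k j\<close> below are open, and a measure carried by a finite \<open>F \<subseteq> G\<close> lies in all of them, the
  witness being a tent function that equals 1 on \<open>F\<close> and vanishes outside the balls. The exceptional
  masses are summable in \<open>k\<close>, which allows intersecting the unions of balls over all \<open>k\<close>.
\<close>
lemma typically_finitely_coverable:
  fixes K :: "'a::metric_space set" and R :: "nat \<Rightarrow> 'a set \<Rightarrow> real \<Rightarrow> bool"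
  assumes "compact K" "G \<subseteq> K" "K \<subseteq> closure G"
    and scales: "\<And>F k. finite F \<Longrightarrow> F \<subseteq> G \<Longrightarrow> \<exists>\<rho>>0. R k F \<rho>"
  shows "typically (weak_topology_on K) (\<lambda>\<mu>. \<forall>\<eta>>0. \<exists>E\<in>sets \<mu>. measure \<mu> E > 1 - \<eta> \<and>
    (\<forall>k. \<exists>F \<rho>. finite F \<and> F \<subseteq> K \<and> 0 < \<rho> \<and> R k F \<rho> \<and> E \<subseteq> (\<Union>x\<in>F. ball x \<rho>)))"
proof -
  define A where "A k = {f. continuous_on K f \<and> bounded (f ` K) \<and>
      (\<exists>F \<rho>. finite F \<and> F \<subseteq> K \<and> 0 < \<rho> \<and> R k F \<rho> \<and>
        (\<forall>x\<in>K. f x \<le> indicat_real (\<Union>x\<in>F. ball x \<rho>) x))}" for k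
  \<comment> \<open>The masses missed for the indices \<open>k\<close> add up to \<open>(1/2)^(j+1)\<close>.\<close>
  define V where "V k j = (\<Union>f\<in>A k. {\<mu> \<in> prob_measures_on K. 1 - (1/2)^(j+k+2) < integral\<^sup>L \<mu> f})"
    for k j :: nat
  define D where "D = (\<Inter>(k, j). V k j)"
  have "openin (weak_topology_on K) (V k j)" for k j
    unfolding V_def by (intro openin_Union) (auto simp: A_def intro: openin_integral_greater)
  then have "gdelta_in (weak_topology_on K) D"
    unfolding D_def by (intro gdelta_in_Inter) (auto intro: open_imp_gdelta_in)
  moreover have "weak_topology_on K closure_of D = topspace (weak_topology_on K)"
  proof -
    have "{\<nu> \<in> prob_measures_on K. \<exists>F. finite F \<and> F \<subseteq> G \<and> (AE x in \<nu>. x \<in> F)} \<subseteq> D"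
    proof safe
      fix \<nu> F
      assume \<nu>: "\<nu> \<in> prob_measures_on K" and F: "finite F" "F \<subseteq> G" "AE x in \<nu>. x \<in> F"
      interpret prob_space \<nu> using \<nu> by (simp add: prob_measures_on_def)
      have "F \<noteq> {}" using F(3) prob_space by (auto simp: AE_False)
      show "\<nu> \<in> D" unfolding D_def
      proof (intro INT_I, clarify)
        fix k j
        obtain \<rho> where \<rho>: "0 < \<rho>" "R k F \<rho>" using scales[OF F(1,2)] by blast
        define f where "f x = max 0 (1 - infdist x F / \<rho>)" for x
        have "continuous_on K f"
          unfolding f_def using \<rho> by (intro continuous_intros) auto
        moreover have "bounded (f ` K)"
          unfolding bounded_iff by (intro exI[of _ 1]) (use \<rho> in \<open>auto simp: f_def infdist_nonneg\<close>)
        moreover have "f x \<le> indicat_real (\<Union>x\<in>F. ball x \<rho>) x" for x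
        proof (cases "x \<in> (\<Union>x\<in>F. ball x \<rho>)")
          case True
          then show ?thesis using \<rho> by (auto simp: f_def infdist_nonneg)
        next
          case False
          then have "\<rho> \<le> infdist x F"
            unfolding infdist_notempty[OF \<open>F \<noteq> {}\<close>]
            by (intro cINF_greatest \<open>F \<noteq> {}\<close>) (auto simp: dist_commute not_less)
          then show ?thesis using \<rho> by (simp add: f_def)
        qed
        ultimately have "f \<in> A k"
          unfolding A_def using F(1,2) \<rho> \<open>G \<subseteq> K\<close> by blast
        moreover have "integral\<^sup>L \<nu> f = 1"
        proof -
          have "AE x in \<nu>. f x = 1" using F(3) by eventually_elim (simp add: f_def)
          moreover have "f \<in> borel_measurable \<nu>"
            using \<open>continuous_on K f\<close> \<open>bounded (f ` K)\<close> integrable_bounded_continuous[OF \<nu>] by blast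
          ultimately have "integral\<^sup>L \<nu> f = integral\<^sup>L \<nu> (\<lambda>_. 1)"
            by (intro integral_cong_AE) auto
          then show ?thesis by (simp add: prob_space)
        qed
        ultimately show "\<nu> \<in> V k j" using \<nu> by (auto simp: V_def intro!: bexI[of _ f])
      qed
    qed
    then show ?thesis
      using finitely_supported_dense[OF assms(1-3)] closure_of_mono closure_of_subset_topspace
      by (metis (no_types, lifting) subset_antisym)
  qed
  moreover have "\<exists>E\<in>sets \<mu>. measure \<mu> E > 1 - \<eta> \<and>
    (\<forall>k. \<exists>F \<rho>. finite F \<and> F \<subseteq> K \<and> 0 < \<rho> \<and> R k F \<rho> \<and> E \<subseteq> (\<Union>x\<in>F. ball x \<rho>))"
    if "\<mu> \<in> D" "0 < \<eta>" for \<mu> \<eta>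
  proof -
    obtain j where j: "(1/2)^j < \<eta>"
      using real_arch_pow_inv[OF \<open>0 < \<eta>\<close>, of "1/2"] by auto
    have "\<forall>k. \<mu> \<in> V k j" using that(1) by (auto simp: D_def)
    then have \<mu>: "\<mu> \<in> prob_measures_on K" and "\<forall>k. \<exists>f\<in>A k. 1 - (1/2)^(j+k+2) < integral\<^sup>L \<mu> f"
      by (auto simp: V_def)
    then obtain f where f: "\<And>k. f k \<in> A k" "\<And>k. 1 - (1/2)^(j+k+2) < integral\<^sup>L \<mu> (f k)"
      by metis
    have fc: "continuous_on K (f k)" "bounded (f k ` K)" for k using f(1)[of k] by (auto simp: A_def)
    have "\<exists>F \<rho>. finite F \<and> F \<subseteq> K \<and> 0 < \<rho> \<and> R k F \<rho> \<and>
        (\<forall>x\<in>K. f k x \<le> indicat_real (\<Union>x\<in>F. ball x \<rho>) x)" for k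
      using f(1)[of k] unfolding A_def by blast
    then obtain F \<rho> where F: "\<And>k. finite (F k) \<and> F k \<subseteq> K \<and> 0 < \<rho> k \<and> R k (F k) (\<rho> k) \<and>
        (\<forall>x\<in>K. f k x \<le> indicat_real (\<Union>x\<in>F k. ball x (\<rho> k)) x)" by metis
    have sets: "sets \<mu> = sets (restrict_space borel K)" and "prob_space \<mu>"
      using \<mu> by (auto simp: prob_measures_on_def)
    interpret prob_space \<mu> by fact
    have sp: "space \<mu> = K"
      using sets_eq_imp_space_eq[OF sets] by (simp add: space_restrict_space)
    define W where "W k = K \<inter> (\<Union>x\<in>F k. ball x (\<rho> k))" for k
    have W: "W k \<in> sets \<mu>" for k
      unfolding sets W_def sets_restrict_space by (intro imageI borel_open) auto
    have "1 - (1/2)^(j+k+2) < prob (W k)" for k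
    proof -
      have "integrable \<mu> (indicat_real (W k))"
        using W by (intro integrable_real_indicator) (auto simp: less_top[symmetric])
      then have "integral\<^sup>L \<mu> (f k) \<le> integral\<^sup>L \<mu> (indicat_real (W k))"
        using F[of k] by (intro integral_mono integrable_bounded_continuous[OF \<mu> fc])
          (auto simp: sp W_def indicator_def)
      then show ?thesis using f(2)[of k] W by simp
    qed
    from this prob_compl[OF W, unfolded sp] have C: "prob (K - W k) \<le> (1/2)^(j+k+2)" for k
      by (metis diff_le_eq diff_add_cancel less_imp_le add.commute)
    have geom: "(\<lambda>k. (1/2)^(j+2) * (1/2)^k) sums ((1/2)^(j+2) * (2::real))"
      using sums_mult[OF geometric_sums[of "1/2 :: real"], of "(1/2)^(j+2)"] by simp
    have C': "prob (K - W k) \<le> (1/2)^(j+2) * (1/2)^k" for k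
      using C[of k] by (simp add: power_add ac_simps)
    have sm: "summable (\<lambda>k. prob (K - W k))"
      by (rule summable_comparison_test'[OF sums_summable[OF geom], of 0])
        (simp only: real_norm_def abs_of_nonneg measure_nonneg C')
    have KW: "K - W k \<in> events" for k
      using W[of k] sets.compl_sets[of "W k" \<mu>] by (simp add: sp)
    have "prob (\<Union>k. K - W k) \<le> (\<Sum>k. prob (K - W k))"
      using KW by (intro finite_measure_subadditive_countably sm) auto
    also have "\<dots> \<le> (\<Sum>k. (1/2)^(j+2) * (1/2)^k)"
      by (rule suminf_le[OF C' sm sums_summable[OF geom]])
    also have "\<dots> = (1/2)^(j+2) * 2"
      using geom by (rule sums_unique[symmetric])
    also have "\<dots> < \<eta>" using j \<open>0 < \<eta>\<close> by simp
    finally have less: "prob (\<Union>k. K - W k) < \<eta>" .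
    have "(\<Union>k. K - W k) \<in> events" using KW by blast
    moreover have "space \<mu> - (\<Union>k. K - W k) = (\<Inter>k. W k)" by (auto simp: sp W_def)
    ultimately have "prob (\<Inter>k. W k) = 1 - prob (\<Union>k. K - W k)"
      using prob_compl by metis
    then have "prob (\<Inter>k. W k) > 1 - \<eta>" using less by linarith
    moreover have "(\<Inter>k. W k) \<in> sets \<mu>" using W by auto
    moreover have "\<forall>k. \<exists>F \<rho>. finite F \<and> F \<subseteq> K \<and> 0 < \<rho> \<and> R k F \<rho> \<and> (\<Inter>k. W k) \<subseteq> (\<Union>x\<in>F. ball x \<rho>)"
    proof
      fix k
      show "\<exists>F \<rho>. finite F \<and> F \<subseteq> K \<and> 0 < \<rho> \<and> R k F \<rho> \<and> (\<Inter>k. W k) \<subseteq> (\<Union>x\<in>F. ball x \<rho>)"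
        using F[of k] by (intro exI[of _ "F k"] exI[of _ "\<rho> k"]) (auto simp: W_def)
    qed
    ultimately show ?thesis by blast
  qed
  ultimately show ?thesis unfolding typically_def by blast
qed

section \<open>Multifractal covering numbers and box dimensions\<close>

lemma log_ext_mono: "x \<le> y \<Longrightarrow> log_ext x \<le> log_ext y"
  unfolding log_ext_def
  by (cases x; cases y) (auto simp: ennreal_eq_0_iff top_unique not_le infinity_ennreal_def intro!: ln_mono)

lemma log_ext_ennreal: "0 < x \<Longrightarrow> log_ext (ennreal x) = ereal (ln x)"
  by (auto simp: log_ext_def ennreal_eq_0_iff infinity_ennreal_def)

text \<open>
  A cover of a nonempty set has at least one member.
\<close>
lemma covering_number_ge:
  assumes "E \<noteq> {}" "\<And>x. x \<in> K \<Longrightarrow> b \<le> measure \<pi> (ball x r) powr q"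
  shows "ennreal b \<le> covering_number K \<pi> q E r"
  unfolding covering_number_def
proof (rule INF_greatest, clarify)
  fix I :: "nat set" and x :: "nat \<Rightarrow> 'a"
  assume *: "x ` I \<subseteq> K" "E \<subseteq> (\<Union>i\<in>I. ball (x i) r)"
  then obtain i where i: "i \<in> I" using assms(1) by blast
  have "ennreal b \<le> (\<Sum>i\<in>{i}. ennreal (measure \<pi> (ball (x i) r) powr q))"
    using assms(2) * i by (auto intro!: ennreal_leI)
  also have "\<dots> \<le> (\<Sum>\<^sub>\<infinity>i\<in>I. ennreal (measure \<pi> (ball (x i) r) powr q))"
    unfolding nonneg_infsum_complete[OF zero_le]
    by (rule SUP_upper) (use i in auto)
  finally show "ennreal b \<le> (\<Sum>\<^sub>\<infinity>i\<in>I. ennreal (measure \<pi> (ball (x i) r) powr q))" .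
qed

lemma covering_number_le:
  assumes "finite F" "F \<subseteq> K" "E \<subseteq> (\<Union>x\<in>F. ball x r)"
    "\<And>x. x \<in> F \<Longrightarrow> measure \<pi> (ball x r) powr q \<le> b"
  shows "covering_number K \<pi> q E r \<le> ennreal (real (card F) * b)"
proof -
  obtain x :: "nat \<Rightarrow> 'a" where x: "bij_betw x {..<card F} F"
    using ex_bij_betw_nat_finite[OF assms(1)] by (auto simp: atLeast0LessThan)
  then have im: "x ` {..<card F} = F" by (simp add: bij_betw_def)
  have "covering_number K \<pi> q E r
      \<le> (\<Sum>\<^sub>\<infinity>i\<in>{..<card F}. ennreal (measure \<pi> (ball (x i) r) powr q))"
    unfolding covering_number_def
  proof (rule INF_lower2[of "({..<card F}, x)"])
    have "(\<Union>i<card F. ball (x i) r) = (\<Union>y\<in>x ` {..<card F}. ball y r)" by blast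
    then show "({..<card F}, x) \<in> {(I, x). x ` I \<subseteq> K \<and> E \<subseteq> (\<Union>i\<in>I. ball (x i) r)}"
      using assms(2,3) im by simp
  qed simp
  also have "\<dots> = ennreal (\<Sum>i<card F. measure \<pi> (ball (x i) r) powr q)"
    by simp
  also have "\<dots> \<le> ennreal (\<Sum>i<card F. b)"
    by (intro ennreal_leI sum_mono assms(4)) (use im in auto)
  finally show ?thesis by simp
qed

text \<open>
  The constant \<open>c\<close> disappears in the limit because \<open>ln c / (- ln r)\<close> tends to 0.
\<close>
lemma lower_box_dim_ge:
  assumes "E \<noteq> {}" "0 < c"
    "\<And>x r. x \<in> K \<Longrightarrow> 0 < r \<Longrightarrow> r < 1 \<Longrightarrow> c * r powr a \<le> measure \<pi> (ball x r) powr q"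
  shows "ereal (- a) \<le> lower_box_dim K \<pi> q E"
proof -
  have lim: "((\<lambda>r. - a + ln c / (- ln r)) \<longlongrightarrow> - a + 0) (at_right 0)"
    by (intro tendsto_add tendsto_const real_tendsto_divide_at_top)
      (auto intro: filterlim_compose[OF filterlim_uminus_at_top_at_bot ln_at_0])
  have "ereal (- a) = Liminf (at_right 0) (\<lambda>r. ereal (- a + ln c / (- ln r)))"
    using lim_imp_Liminf[of "at_right (0::real)" "\<lambda>r. ereal (- a + ln c / (- ln r))" "ereal (-a)"] lim
    by simp
  also have "\<dots> \<le> lower_box_dim K \<pi> q E"
    unfolding lower_box_dim_def
  proof (rule Liminf_mono)
    show "\<forall>\<^sub>F r in at_right 0. ereal (- a + ln c / (- ln r))
        \<le> log_ext (covering_number K \<pi> q E r) / ereal (- ln r)"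
      using eventually_at_right_less[of "0::real"] eventually_at_right_real[of 0 "1::real", simplified]
    proof eventually_elim
      case (elim r)
      then have r: "0 < r" "r < 1" by auto
      then have l: "0 < - ln r" by simp
      have "ereal (- a + ln c / (- ln r)) = ereal (ln (c * r powr a)) / ereal (- ln r)"
        using r assms(2) l by (simp add: ln_mult ln_powr field_simps)
      also have "ereal (ln (c * r powr a)) = log_ext (ennreal (c * r powr a))"
        using r assms(2) by (simp add: log_ext_ennreal)
      also have "\<dots> / ereal (- ln r) \<le> log_ext (covering_number K \<pi> q E r) / ereal (- ln r)"
        using l r by (intro ereal_divide_right_mono log_ext_mono covering_number_ge assms) auto
      finally show ?case .
    qed
  qed
  finally show ?thesis .
qed

text \<open>
  A lower limit is bounded by the values along any sequence of scales, so arbitrarily small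
  good scales suffice.
\<close>
lemma lower_box_dim_le:
  assumes "\<And>t \<delta>. 0 < t \<Longrightarrow> 0 < \<delta> \<Longrightarrow>
    \<exists>r. 0 < r \<and> r < \<delta> \<and> covering_number K \<pi> q E r \<le> ennreal (r powr (a - t))"
  shows "lower_box_dim K \<pi> q E \<le> ereal (- a)"
proof (rule ereal_le_epsilon2)
  fix t :: real assume t: "0 < t"
  have "\<not> (\<forall>\<^sub>F r in at_right 0. ereal (- a + t) < log_ext (covering_number K \<pi> q E r) / ereal (- ln r))"
  proof
    assume "\<forall>\<^sub>F r in at_right 0. ereal (- a + t) < log_ext (covering_number K \<pi> q E r) / ereal (- ln r)"
    then obtain \<delta> where \<delta>: "0 < \<delta>"
      "\<And>r. 0 < r \<Longrightarrow> r < \<delta> \<Longrightarrow> ereal (- a + t) < log_ext (covering_number K \<pi> q E r) / ereal (- ln r)"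
      by (auto simp: eventually_at_right_field)
    obtain r where r: "0 < r" "r < min \<delta> 1" "covering_number K \<pi> q E r \<le> ennreal (r powr (a - t))"
      using assms[OF t, of "min \<delta> 1"] \<delta>(1) by auto
    have l: "0 < - ln r" using r by simp
    have "log_ext (covering_number K \<pi> q E r) \<le> ereal (ln (r powr (a - t)))"
      using log_ext_mono[OF r(3)] r(1) by (simp add: log_ext_ennreal)
    then have "log_ext (covering_number K \<pi> q E r) / ereal (- ln r)
        \<le> ereal (ln (r powr (a - t))) / ereal (- ln r)"
      using l by (intro ereal_divide_right_mono) auto
    also have "\<dots> = ereal (- a + t)"
      using l r by (simp add: ln_powr field_simps)
    finally show False using \<delta>(2)[of r] r by auto
  qed
  then have "\<not> ereal (- a + t) < lower_box_dim K \<pi> q E"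
    unfolding lower_box_dim_def using less_LiminfD by blast
  then show "lower_box_dim K \<pi> q E \<le> ereal (- a) + ereal t" by simp
qed

text \<open>
  For every \<open>\<epsilon>\<close> in \<open>(0, 1]\<close> the sets with \<open>measure \<mu> E > 1 - \<epsilon>\<close> are nonempty, so the infimum over them
  equals \<open>a\<close>. The case \<open>\<epsilon> = 1\<close> is the small dimension, and the big one is the limit of a constant.
\<close>
lemma box_dims_eqI:
  assumes lower: "\<And>E. E \<noteq> {} \<Longrightarrow> a \<le> lower_box_dim K \<pi> q E"
    and upper: "\<And>\<eta>. 0 < \<eta> \<Longrightarrow> \<exists>E\<in>sets \<mu>. measure \<mu> E > 1 - \<eta> \<and> lower_box_dim K \<pi> q E \<le> a"
  shows "small_lower_box_dim K \<pi> q \<mu> = a" "big_lower_box_dim K \<pi> q \<mu> = a"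
proof -
  have inf: "(INF E \<in> {E \<in> sets \<mu>. measure \<mu> E > 1 - \<epsilon>}. lower_box_dim K \<pi> q E) = a"
    if \<epsilon>: "0 < \<epsilon>" "\<epsilon> \<le> 1" for \<epsilon>
  proof (rule antisym)
    obtain E where "E \<in> sets \<mu>" "measure \<mu> E > 1 - \<epsilon>" "lower_box_dim K \<pi> q E \<le> a"
      using upper[OF \<epsilon>(1)] by blast
    then show "(INF E \<in> {E \<in> sets \<mu>. measure \<mu> E > 1 - \<epsilon>}. lower_box_dim K \<pi> q E) \<le> a"
      by (intro INF_lower2[of E]) auto
    show "a \<le> (INF E \<in> {E \<in> sets \<mu>. measure \<mu> E > 1 - \<epsilon>}. lower_box_dim K \<pi> q E)"
      using \<epsilon> by (intro INF_greatest lower) auto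
  qed
  show "small_lower_box_dim K \<pi> q \<mu> = a"
    using inf[of 1] unfolding small_lower_box_dim_def by simp
  have "\<forall>\<^sub>F \<epsilon> in at_right 0.
      (INF E \<in> {E \<in> sets \<mu>. measure \<mu> E > 1 - \<epsilon>}. lower_box_dim K \<pi> q E) = a"
    using eventually_at_right_less[of "0::real"] eventually_at_right_real[of 0 "1::real", simplified]
    by eventually_elim (use inf in auto)
  then show "big_lower_box_dim K \<pi> q \<mu> = a"
    unfolding big_lower_box_dim_def
    by (intro tendsto_Lim tendsto_eventually) (auto simp: trivial_limit_at_right_real)
qed

section \<open>Packings, similarities and small powers\<close>

text \<open>
  In a finite cover of the compact ball by balls of radius \<open>\<delta>/2\<close>, each of these contains at most one
  point of a \<open>\<delta>\<close>-separated set.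
\<close>
lemma separated_card_bound:
  fixes R \<delta> :: real
  assumes "0 < \<delta>"
  shows "\<exists>N::nat. \<forall>F :: 'a::euclidean_space set. F \<subseteq> cball 0 R \<longrightarrow>
    (\<forall>x\<in>F. \<forall>y\<in>F. x \<noteq> y \<longrightarrow> \<delta> \<le> dist x y) \<longrightarrow> finite F \<and> card F \<le> N"
proof -
  have "cball (0::'a) R \<subseteq> (\<Union>c\<in>cball 0 R. ball c (\<delta>/2))" using assms by auto
  then obtain C where C: "finite C" "cball (0::'a) R \<subseteq> (\<Union>c\<in>C. ball c (\<delta>/2))"
    using compactE_image[OF compact_cball, of "cball (0::'a) R" "\<lambda>c. ball c (\<delta>/2)" 0 R]
    by (metis open_ball)
  show ?thesis
  proof (intro exI[of _ "card C"] allI impI)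
    fix F :: "'a set"
    assume F: "F \<subseteq> cball 0 R" and sep: "\<forall>x\<in>F. \<forall>y\<in>F. x \<noteq> y \<longrightarrow> \<delta> \<le> dist x y"
    have "\<forall>x\<in>F. \<exists>c\<in>C. dist c x < \<delta>/2" using F C(2) by (auto simp: subset_eq)
    then obtain c where c: "\<And>x. x \<in> F \<Longrightarrow> c x \<in> C" "\<And>x. x \<in> F \<Longrightarrow> dist (c x) x < \<delta>/2"
      by metis
    have "inj_on c F"
    proof (rule inj_onI, rule ccontr)
      fix x y assume xy: "x \<in> F" "y \<in> F" "c x = c y" "x \<noteq> y"
      have "dist x y < \<delta>"
        using dist_triangle_half_r[of "c x" x \<delta> y] c(2)[OF xy(1)] c(2)[OF xy(2)] xy(3)
        by (simp add: dist_commute)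
      then show False using sep xy by force
    qed
    moreover have "c ` F \<subseteq> C" using c(1) by blast
    ultimately show "finite F \<and> card F \<le> card C"
      using C(1) by (meson card_inj_on_le inj_on_finite)
  qed
qed

text \<open>
  A similarity of a Euclidean space is surjective, since after translation and rescaling it
  becomes an orthogonal transformation.
\<close>
lemma similarity_ball:
  fixes f :: "'a::euclidean_space \<Rightarrow> 'a"
  assumes "0 < c" and f: "\<And>x y. dist (f x) (f y) = c * dist x y"
  shows "ball (f z) (c * a) \<subseteq> f ` ball z a"
proof
  fix y assume y: "y \<in> ball (f z) (c * a)"
  define g where "g x = (f x - f 0) /\<^sub>R c" for x
  have "orthogonal_transformation g"
    unfolding orthogonal_transformation_isometry
  proof (intro conjI allI)
    fix x y
    have "dist (g x) (g y) = dist (f x - f 0) (f y - f 0) / c"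
      unfolding g_def dist_norm scaleR_diff_right[symmetric] norm_scaleR
      using assms(1) by (simp add: divide_inverse mult.commute)
    then show "dist (g x) (g y) = dist x y"
      using assms(1) f[of x y] by (simp add: dist_norm)
  qed (simp add: g_def)
  then obtain x where "g x = (y - f 0) /\<^sub>R c"
    by (metis orthogonal_transformation_surj surjD)
  then have "f x = y" using assms(1) by (simp add: g_def)
  moreover have "dist z x < a" using y f[of z x] \<open>f x = y\<close> assms(1) by simp
  ultimately show "y \<in> f ` ball z a" by auto
qed

lemma powr_le_of_small:
  fixes \<rho> C t :: real
  assumes "0 \<le> \<rho>" "\<rho> < C powr (1/t)" "0 < t" "0 < C"
  shows "\<rho> powr t \<le> C"
proof -
  have "\<rho> powr t \<le> (C powr (1/t)) powr t" using assms by (intro powr_mono2) auto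
  then show ?thesis using assms by (simp add: powr_powr)
qed

lemma ex_geometric_small:
  fixes c C q t \<delta> :: real
  assumes "0 < c" "0 < C" "0 < q" "q < 1" "0 < t" "0 < \<delta>"
  shows "\<exists>n. c * q^n < \<delta> \<and> (c * q^n) powr t \<le> C"
proof -
  have "0 < min \<delta> (C powr (1/t)) / c" using assms by simp
  then obtain n where "q^n < min \<delta> (C powr (1/t)) / c"
    using real_arch_pow_inv assms(4) by blast
  then have "c * q^n < min \<delta> (C powr (1/t))" using assms by (simp add: field_simps)
  then show ?thesis using assms powr_le_of_small[of "c * q^n" C t] by auto
qed

section \<open>Words over a self-similar iterated function system\<close>

locale self_similar_measure =
  fixes M :: nat and S :: "nat \<Rightarrow> 'a::euclidean_space \<Rightarrow> 'a" and r p :: "nat \<Rightarrow> real"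
    and K :: "'a set" and \<pi> :: "'a measure"
  assumes contracting: "\<And>m. m \<in> {1..M} \<Longrightarrow> contracting_similarity (r m) (S m)"
    and p_pos: "\<And>m. m \<in> {1..M} \<Longrightarrow> 0 < p m"
    and p_sum: "(\<Sum>m\<in>{1..M}. p m) = 1"
    and K_nonempty: "K \<noteq> {}" and K_compact: "compact K"
    and K_union: "K = (\<Union>m\<in>{1..M}. S m ` K)"
    and prob_space_\<pi>: "prob_space \<pi>" and sets_\<pi>: "sets \<pi> = sets borel"
    and \<pi>_sum: "\<And>A. A \<in> sets borel \<Longrightarrow>
           measure \<pi> A = (\<Sum>m\<in>{1..M}. p m * measure \<pi> (S m -` A))"
    and osc: "open_set_condition M S"
begin

sublocale prob_space \<pi> by (rule prob_space_\<pi>)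

lemma space_\<pi> [simp]: "space \<pi> = UNIV"
  using sets_eq_imp_space_eq[OF sets_\<pi>] by simp

lemma letters_nonempty: "{1..M} \<noteq> {}"
  using p_sum by (metis sum.empty zero_neq_one)

lemma r_pos: "m \<in> {1..M} \<Longrightarrow> 0 < r m"
  and r_less_1: "m \<in> {1..M} \<Longrightarrow> r m < 1"
  and dist_S: "m \<in> {1..M} \<Longrightarrow> dist (S m x) (S m y) = r m * dist x y"
  using contracting by (auto simp: contracting_similarity_def)

lemma p_le_1: "m \<in> {1..M} \<Longrightarrow> p m \<le> 1"
  using member_le_sum[of m "{1..M}" p] p_pos p_sum by (auto simp: less_imp_le)

definition "rmin = Min (r ` {1..M})"
definition "rmax = Max (r ` {1..M})"
definition "smin = Min ((\<lambda>m. ln (p m) / ln (r m)) ` {1..M})"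
definition "smax = Max ((\<lambda>m. ln (p m) / ln (r m)) ` {1..M})"

lemma rmin_pos: "0 < rmin" and rmin_le: "m \<in> {1..M} \<Longrightarrow> rmin \<le> r m"
  and rmax_less_1: "rmax < 1" and rmax_ge: "m \<in> {1..M} \<Longrightarrow> r m \<le> rmax"
  using letters_nonempty r_pos r_less_1 unfolding rmin_def rmax_def
  by (auto simp: Min_gr_iff Max_less_iff)

lemma rmax_pos: "0 < rmax"
  using letters_nonempty r_pos rmax_ge by (metis ex_in_conv less_le_trans)

lemma rmin_le_1: "rmin \<le> 1"
  using letters_nonempty rmin_le r_less_1 by (metis ex_in_conv less_imp_le order_trans)

lemma p_eq_powr: "m \<in> {1..M} \<Longrightarrow> p m = r m powr (ln (p m) / ln (r m))"
  using r_pos[of m] r_less_1[of m] p_pos[of m] by (simp add: powr_def)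

lemma smin_nonneg: "0 \<le> smin" and smax_nonneg: "0 \<le> smax"
proof -
  have *: "0 \<le> ln (p m) / ln (r m)" if "m \<in> {1..M}" for m
    using that r_pos[of m] r_less_1[of m] p_pos[of m] p_le_1[of m] by (simp add: divide_nonpos_neg)
  show "0 \<le> smin" unfolding smin_def using letters_nonempty * by (subst Min_ge_iff) auto
  have "smax \<in> (\<lambda>m. ln (p m) / ln (r m)) ` {1..M}"
    unfolding smax_def using letters_nonempty by (intro Max_in) auto
  then show "0 \<le> smax" using * by auto
qed

lemma p_ge_powr: "m \<in> {1..M} \<Longrightarrow> r m powr smax \<le> p m"
  using p_eq_powr[of m] powr_mono'[of "ln (p m) / ln (r m)" smax "r m"] r_pos[of m] r_less_1[of m]
    Max_ge[of "(\<lambda>m. ln (p m) / ln (r m)) ` {1..M}" "ln (p m) / ln (r m)"]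
  by (simp add: smax_def)

lemma p_le_powr: "m \<in> {1..M} \<Longrightarrow> p m \<le> r m powr smin"
  by (subst p_eq_powr, assumption)
     (auto intro!: powr_mono' Min_le simp: smin_def r_pos r_less_1 less_imp_le)

lemma ex_max_letter: "\<exists>m\<in>{1..M}. p m = r m powr smax"
proof -
  have "smax \<in> (\<lambda>m. ln (p m) / ln (r m)) ` {1..M}"
    unfolding smax_def using letters_nonempty by (intro Max_in) auto
  then show ?thesis using p_eq_powr by (metis (no_types, lifting) imageE)
qed

lemma ex_min_letter: "\<exists>m\<in>{1..M}. p m = r m powr smin"
proof -
  have "smin \<in> (\<lambda>m. ln (p m) / ln (r m)) ` {1..M}"
    unfolding smin_def using letters_nonempty by (intro Min_in) auto
  then show ?thesis using p_eq_powr by (metis (no_types, lifting) imageE)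
qed

primrec word_map :: "nat list \<Rightarrow> 'a \<Rightarrow> 'a" where
  "word_map [] x = x"
| "word_map (m # v) x = S m (word_map v x)"

definition "ratio v = prod_list (map r v)"
definition "weight v = prod_list (map p v)"

lemma ratio_simps [simp]: "ratio [] = 1" "ratio (m # v) = r m * ratio v"
    "ratio (u @ v) = ratio u * ratio v" "ratio (replicate n m) = r m ^ n"
  by (simp_all add: ratio_def prod_list_replicate)

lemma weight_simps [simp]: "weight [] = 1" "weight (m # v) = p m * weight v"
    "weight (u @ v) = weight u * weight v" "weight (replicate n m) = p m ^ n"
  by (simp_all add: weight_def prod_list_replicate)

lemma word_map_append: "word_map (u @ v) x = word_map u (word_map v x)"
  by (induction u) auto

lemma ratio_pos: "v \<in> lists {1..M} \<Longrightarrow> 0 < ratio v"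
  by (induction v) (auto simp: r_pos)

lemma ratio_le_1: "v \<in> lists {1..M} \<Longrightarrow> ratio v \<le> 1"
proof (induction v)
  case (Cons m v)
  then show ?case using r_pos[of m] r_less_1[of m] ratio_pos[of v] by (auto intro!: mult_le_one)
qed simp

lemma weight_pos: "v \<in> lists {1..M} \<Longrightarrow> 0 < weight v"
  by (induction v) (auto simp: p_pos)

lemma weight_le_1: "v \<in> lists {1..M} \<Longrightarrow> weight v \<le> 1"
proof (induction v)
  case (Cons m v)
  then show ?case using p_le_1[of m] weight_pos[of v] by (auto intro!: mult_le_one)
qed simp

text \<open>
  These two bounds are what singles out \<open>smin\<close> and \<open>smax\<close>: they hold letter by letter and are
  preserved by products.
\<close>
lemma weight_ge_powr: "v \<in> lists {1..M} \<Longrightarrow> ratio v powr smax \<le> weight v"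
proof (induction v)
  case (Cons m v)
  then show ?case
    using r_pos[of m] ratio_pos[of v] p_ge_powr[of m] p_pos[of m]
    by (auto simp: powr_mult less_imp_le intro!: mult_mono)
qed simp

lemma weight_le_powr: "v \<in> lists {1..M} \<Longrightarrow> weight v \<le> ratio v powr smin"
proof (induction v)
  case (Cons m v)
  then show ?case
    using r_pos[of m] ratio_pos[of v] p_le_powr[of m] weight_pos[of v]
    by (auto simp: powr_mult intro!: mult_mono)
qed simp

lemma dist_word_map:
  "v \<in> lists {1..M} \<Longrightarrow> dist (word_map v x) (word_map v y) = ratio v * dist x y"
  by (induction v) (auto simp: dist_S)

lemma word_map_K: "v \<in> lists {1..M} \<Longrightarrow> x \<in> K \<Longrightarrow> word_map v x \<in> K"
proof (induction v)
  case (Cons m v)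
  then show ?case by (subst K_union) auto
qed simp

lemma word_map_continuous: "v \<in> lists {1..M} \<Longrightarrow> continuous_on A (word_map v)"
  by (rule lipschitz_on_continuous_on[of "ratio v"], rule lipschitz_onI)
    (auto simp: dist_word_map less_imp_le[OF ratio_pos])

lemma S_measurable: "m \<in> {1..M} \<Longrightarrow> A \<in> sets borel \<Longrightarrow> S m -` A \<in> sets borel"
  using measurable_sets[OF borel_measurable_continuous_onI[OF word_map_continuous[of "[m]" UNIV]], of A]
  by (simp add: vimage_def)

section \<open>Cut sets of words of comparable ratio\<close>

text \<open>
  \<open>stopped \<rho> v\<close> means that \<open>v\<close> is the shortest prefix of itself whose ratio is at most \<open>\<rho>\<close>. The rules
  read the word from its first letter, which matches the self-similarity equation of \<open>\<pi>\<close>; rescaling \<open>\<rho>\<close>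
  by \<open>r m\<close> accounts for the letter that has been read.
\<close>
inductive stopped :: "real \<Rightarrow> nat list \<Rightarrow> bool" where
  stop: "1 \<le> \<rho> \<Longrightarrow> stopped \<rho> []"
| continue: "\<rho> < 1 \<Longrightarrow> m \<in> {1..M} \<Longrightarrow> stopped (\<rho> / r m) v \<Longrightarrow> stopped \<rho> (m # v)"

definition "cutset \<rho> = {v. stopped \<rho> v}"

lemma cutset_ge_1: "1 \<le> \<rho> \<Longrightarrow> cutset \<rho> = {[]}"
  by (auto simp: cutset_def intro: stop elim: stopped.cases)

lemma cutset_less_1: "\<rho> < 1 \<Longrightarrow> cutset \<rho> = (\<Union>m\<in>{1..M}. (#) m ` cutset (\<rho> / r m))"
proof (rule set_eqI)
  fix v assume "\<rho> < 1"
  then have "stopped \<rho> v \<longleftrightarrow> (\<exists>m\<in>{1..M}. \<exists>w. v = m # w \<and> stopped (\<rho> / r m) w)"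
    by (subst stopped.simps) auto
  then show "v \<in> cutset \<rho> \<longleftrightarrow> v \<in> (\<Union>m\<in>{1..M}. (#) m ` cutset (\<rho> / r m))"
    by (auto simp: cutset_def)
qed

lemma cutset_words: "v \<in> cutset \<rho> \<Longrightarrow> v \<in> lists {1..M}"
  unfolding cutset_def mem_Collect_eq by (induction rule: stopped.induct) auto

text \<open>
  Induction along the recursion that defines the cut sets: every division by some \<open>r m\<close> enlarges the
  scale by a factor of at least \<open>1 / rmax\<close>, so the scale 1 is reached after finitely many steps.
\<close>
lemma scale_induct [consumes 1, case_names large small]:
  assumes "0 < \<rho>"
    and "\<And>\<rho>. 1 \<le> \<rho> \<Longrightarrow> P \<rho>"
    and "\<And>\<rho>. 0 < \<rho> \<Longrightarrow> \<rho> < 1 \<Longrightarrow> (\<And>m. m \<in> {1..M} \<Longrightarrow> P (\<rho> / r m)) \<Longrightarrow> P \<rho>"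
  shows "P \<rho>"
proof -
  obtain n where "rmax ^ n < \<rho>" using real_arch_pow_inv[OF assms(1) rmax_less_1] by blast
  then have "rmax ^ n \<le> \<rho>" by simp
  then show ?thesis
    using assms(1)
  proof (induction n arbitrary: \<rho>)
    case 0
    then show ?case using assms(2) by simp
  next
    case (Suc n)
    show ?case
    proof (cases "1 \<le> \<rho>")
      case False
      have "P (\<rho> / r m)" if m: "m \<in> {1..M}" for m
      proof (rule Suc.IH)
        have "rmax ^ n * r m \<le> rmax ^ n * rmax"
          using rmax_pos rmax_ge[OF m] by (intro mult_left_mono) auto
        also have "\<dots> \<le> \<rho>" using Suc.prems by (simp add: mult.commute)
        finally show "rmax ^ n \<le> \<rho> / r m" using r_pos[OF m] by (simp add: pos_le_divide_eq)
      qed (use Suc.prems r_pos[OF m] in auto)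
      then show ?thesis using assms(3) Suc.prems False by auto
    qed (rule assms(2))
  qed
qed

lemma finite_cutset: "0 < \<rho> \<Longrightarrow> finite (cutset \<rho>)"
  by (induction \<rho> rule: scale_induct) (auto simp: cutset_ge_1 cutset_less_1)

lemma sum_cutset:
  assumes "0 < \<rho>" "\<rho> < 1"
  shows "(\<Sum>v\<in>cutset \<rho>. g v) = (\<Sum>m\<in>{1..M}. \<Sum>v\<in>cutset (\<rho> / r m). g (m # v) :: real)"
  unfolding cutset_less_1[OF assms(2)]
  using assms by (subst sum.UNION_disjoint) (auto simp: sum.reindex finite_cutset r_pos)

lemma measure_cutset:
  assumes "0 < \<rho>" "A \<in> sets borel"
  shows "measure \<pi> A = (\<Sum>v\<in>cutset \<rho>. weight v * measure \<pi> (word_map v -` A))"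
  using assms
proof (induction \<rho> arbitrary: A rule: scale_induct)
  case (large \<rho>)
  then show ?case by (simp add: cutset_ge_1 vimage_def)
next
  case (small \<rho>)
  have "word_map (m # v) -` A = word_map v -` (S m -` A)" for m v by auto
  moreover have "measure \<pi> A = (\<Sum>m\<in>{1..M}. p m * measure \<pi> (S m -` A))"
    using \<pi>_sum[OF small.prems] .
  ultimately show ?case
    using small S_measurable by (simp add: sum_cutset sum_distrib_left mult.assoc)
qed

lemma sum_weight_cutset: "0 < \<rho> \<Longrightarrow> (\<Sum>v\<in>cutset \<rho>. weight v) = 1"
  using measure_cutset[of \<rho> UNIV] prob_space by simp

lemma K_cutset:
  assumes "0 < \<rho>" "x \<in> K"
  shows "\<exists>v\<in>cutset \<rho>. \<exists>y\<in>K. x = word_map v y"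
  using assms
proof (induction \<rho> arbitrary: x rule: scale_induct)
  case (large \<rho>)
  then show ?case by (simp add: cutset_ge_1)
next
  case (small \<rho>)
  from small.prems obtain m y where m: "m \<in> {1..M}" "y \<in> K" "x = S m y" using K_union by blast
  then obtain v z where v: "v \<in> cutset (\<rho> / r m)" "z \<in> K" "y = word_map v z" using small.IH[OF m(1,2)] by blast
  have "m # v \<in> cutset \<rho>" using small m v by (auto simp: cutset_less_1)
  moreover have "x = word_map (m # v) z" using m v by simp
  ultimately show ?case using v(2) by blast
qed

lemma cutset_ratio_le: "v \<in> cutset \<rho> \<Longrightarrow> ratio v \<le> \<rho>"
  unfolding cutset_def mem_Collect_eq
  by (induction rule: stopped.induct) (auto simp: r_pos field_simps)

lemma cutset_ratio_ge:
  assumes "v \<in> cutset \<rho>" "\<rho> \<le> 1"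
  shows "rmin * \<rho> \<le> ratio v"
proof -
  have "stopped \<rho> v \<Longrightarrow> min 1 (rmin * \<rho>) \<le> ratio v"
  proof (induction rule: stopped.induct)
    case (continue \<rho> m v)
    have "rmin * \<rho> \<le> rmin" using continue rmin_pos by simp
    then have "min 1 (rmin * \<rho>) \<le> min (r m) (rmin * \<rho>)"
      using rmin_le[of m] continue by linarith
    also have "\<dots> = r m * min 1 (rmin * (\<rho> / r m))"
      using r_pos[of m] continue by (simp add: min_def field_simps)
    also have "\<dots> \<le> r m * ratio v"
      using r_pos[of m] continue by (intro mult_left_mono) auto
    finally show ?case by simp
  qed simp
  moreover have "rmin * \<rho> \<le> 1" using assms(2) rmin_pos rmin_le_1 
    by (metis mult_le_one mult_left_le order_trans less_imp_le)
  ultimately show ?thesis using assms(1) by (simp add: cutset_def)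
qed

text \<open>
  Prefixing all words by \<open>u\<close> maps a cut set into the cut set of the scale multiplied by \<open>ratio u\<close>. For
  \<open>\<rho> > 1\<close> this fails, since then \<open>v\<close> is empty and \<open>u\<close> may be longer than necessary.
\<close>
lemma cutset_append:
  assumes "v \<in> cutset \<rho>" "\<rho> \<le> 1" "u \<in> lists {1..M}"
  shows "u @ v \<in> cutset (ratio u * \<rho>)"
  using assms(3)
proof (induction u)
  case Nil
  then show ?case using assms by simp
next
  case (Cons m u)
  have "ratio u * \<rho> \<le> 1"
    using ratio_le_1[of u] ratio_pos[of u] Cons assms(2)
    by (metis in_lists_conv_set lists.cases list.distinct(1) list.inject mult_left_le order_trans less_imp_le)
  then have "r m * (ratio u * \<rho>) \<le> r m" using r_pos[of m] Cons by simp
  also have "\<dots> < 1" using r_less_1[of m] Cons by simp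
  finally show ?case
    using Cons r_pos[of m] by (auto simp: cutset_def mult.assoc intro!: continue)
qed

text \<open>
  At the first letter where the two words differ the images are separated by the open set
  condition; such a letter exists because neither of two distinct stopped words is a prefix of the
  other.
\<close>
lemma cutset_disjoint:
  assumes U: "\<And>m. m \<in> {1..M} \<Longrightarrow> S m ` U \<subseteq> U"
    "\<And>l m. l \<in> {1..M} \<Longrightarrow> m \<in> {1..M} \<Longrightarrow> l \<noteq> m \<Longrightarrow> S l ` U \<inter> S m ` U = {}"
    and "v \<in> cutset \<rho>" "w \<in> cutset \<rho>" "v \<noteq> w"
  shows "word_map v ` U \<inter> word_map w ` U = {}"
proof -
  have sub: "word_map v x \<in> U" if "v \<in> lists {1..M}" "x \<in> U" for v x
    using that by (induction v) (use U(1) in auto)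
  have "stopped \<rho> v"  using assms(3) by (simp add: cutset_def)
  then show ?thesis
    using assms(4,5)
  proof (induction arbitrary: w)
    case (stop \<rho>)
    then show ?case by (simp add: cutset_ge_1)
  next
    case (continue \<rho> m v)
    then obtain l w' where w: "w = l # w'" "l \<in> {1..M}" "w' \<in> cutset (\<rho> / r l)"
      by (auto simp: cutset_less_1)
    have vw: "v \<in> lists {1..M}" "w' \<in> lists {1..M}"
      using continue.hyps w cutset_words by (auto simp: cutset_def)
    show ?case
    proof (cases "l = m")
      case True
      have "inj (S m)"
        using dist_S[OF continue.hyps(2)] r_pos[OF continue.hyps(2)]
        by (intro injI) (metis dist_eq_0_iff mult_eq_0_iff less_irrefl)
      moreover have "word_map v ` U \<inter> word_map w' ` U = {}"
        using continue True w by auto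
      ultimately show ?thesis using w True by (auto simp: inj_def)
    next
      case False
      have "word_map (m # v) ` U \<subseteq> S m ` U" "word_map w ` U \<subseteq> S l ` U"
        using sub vw w by auto
      then show ?thesis using U(2)[of m l] continue.hyps w False by auto
    qed
  qed
qed

section \<open>The mass of balls\<close>

text \<open>
  Let \<open>f \<epsilon>\<close> be the mass at distance at least \<open>\<epsilon>\<close> from \<open>K\<close>. The maps contract distances to \<open>K\<close>, so
  self-similarity gives \<open>f \<epsilon> \<le> f (\<epsilon> / rmax)\<close>; iterating pushes the mass to infinity, where there is none.
\<close>
lemma prob_K: "prob K = 1"
proof -
  define f where "f \<epsilon> = prob {x. \<epsilon> \<le> infdist x K}" for \<epsilon>
  have meas: "{x. \<epsilon> \<le> infdist x K} \<in> sets borel" for \<epsilon>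
    by (intro borel_closed closed_Collect_le continuous_intros)
  have mono: "f \<epsilon> \<le> f \<epsilon>'" if "\<epsilon>' \<le> \<epsilon>" for \<epsilon> \<epsilon>'
    unfolding f_def using that meas by (intro finite_measure_mono) (auto simp: sets_\<pi>)
  have step: "f \<epsilon> \<le> f (\<epsilon> / rmax)" if "0 < \<epsilon>" for \<epsilon>
  proof -
    have "S m -` {x. \<epsilon> \<le> infdist x K} \<subseteq> {x. \<epsilon> / r m \<le> infdist x K}" if m: "m \<in> {1..M}" for m
    proof
      fix x assume x: "x \<in> S m -` {x. \<epsilon> \<le> infdist x K}"
      have "\<epsilon> / r m \<le> dist x k" if "k \<in> K" for k
      proof -
        have "S m k \<in> K" using K_union m that by blast
        then have "\<epsilon> \<le> dist (S m x) (S m k)" using x infdist_le order_trans by blast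
        then show ?thesis using dist_S[OF m] r_pos[OF m] by (simp add: pos_divide_le_eq mult.commute)
      qed
      then show "x \<in> {x. \<epsilon> / r m \<le> infdist x K}"
        using K_nonempty by (auto simp: infdist_notempty intro: cINF_greatest)
    qed
    then have *: "prob (S m -` {x. \<epsilon> \<le> infdist x K}) \<le> f (\<epsilon> / rmax)" if m: "m \<in> {1..M}" for m
    proof -
      have "\<epsilon> / rmax \<le> \<epsilon> / r m"
        using rmax_ge[OF m] r_pos[OF m] \<open>0 < \<epsilon>\<close> by (intro divide_left_mono) (auto simp: rmax_pos)
      then show ?thesis
        unfolding f_def using \<open>\<And>m. _ \<Longrightarrow> S m -` _ \<subseteq> _\<close>[OF m] meas
        by (intro finite_measure_mono) (auto simp: sets_\<pi>)
    qed
    have "f \<epsilon> = (\<Sum>m\<in>{1..M}. p m * prob (S m -` {x. \<epsilon> \<le> infdist x K}))"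
      unfolding f_def by (rule \<pi>_sum[OF meas])
    also have "\<dots> \<le> (\<Sum>m\<in>{1..M}. p m * f (\<epsilon> / rmax))"
      using * p_pos by (intro sum_mono mult_left_mono) (auto simp: less_imp_le)
    also have "\<dots> = f (\<epsilon> / rmax)" using p_sum by (simp flip: sum_distrib_right)
    finally show ?thesis .
  qed
  have zero: "f \<epsilon> = 0" if "0 < \<epsilon>" for \<epsilon>
  proof -
    have le: "f \<epsilon> \<le> f (real n)" for n
    proof -
      obtain k where k: "rmax ^ k < \<epsilon> / (real n + 1)"
        using real_arch_pow_inv[of "\<epsilon> / (real n + 1)" rmax] rmax_less_1 \<open>0 < \<epsilon>\<close> by auto
      have "f \<epsilon> \<le> f (\<epsilon> / rmax ^ k)"
      proof (induction k)
        case (Suc k)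
        then show ?case using step[of "\<epsilon> / rmax ^ k"] rmax_pos \<open>0 < \<epsilon>\<close> by (simp add: mult.commute)
      qed simp
      also have "\<dots> \<le> f (real n)"
      proof (rule mono)
        have "rmax ^ k * (real n + 1) < \<epsilon>" using k by (simp add: pos_less_divide_eq)
        then have "rmax ^ k * real n \<le> \<epsilon>" using rmax_pos by (simp add: algebra_simps) (smt (verit) zero_less_power)
        then show "real n \<le> \<epsilon> / rmax ^ k" using rmax_pos by (simp add: pos_le_divide_eq mult.commute)
      qed
      finally show ?thesis .
    qed
    have "(\<lambda>n. f (real n)) \<longlonglongrightarrow> prob (\<Inter>n. {x. real n \<le> infdist x K})"
      unfolding f_def using meas by (intro finite_Lim_measure_decseq) (auto simp: sets_\<pi> decseq_def)
    moreover have "\<exists>n. \<not> real n \<le> infdist x K" for x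
      using reals_Archimedean2 not_le by metis
    then have "(\<Inter>n. {x. real n \<le> infdist x K}) = {}" by auto
    ultimately have "f \<epsilon> \<le> 0" using le by (intro LIMSEQ_le_const) auto
    then show ?thesis unfolding f_def by (simp add: measure_le_0_iff)
  qed
  have "{x. 1 / (real n + 1) \<le> infdist x K} \<in> null_sets \<pi>" for n
    using meas zero[of "1 / (real n + 1)", unfolded f_def]
    by (simp add: null_sets_def emeasure_eq_measure sets_\<pi>)
  then have "prob (\<Union>n. {x. 1 / (real n + 1) \<le> infdist x K}) = 0"
    by (intro measure_eq_0_null_sets null_sets_UN)
  moreover have "(\<Union>n. {x. 1 / (real n + 1) \<le> infdist x K}) = - K"
  proof (rule equalityI; rule subsetI)
    fix x assume "x \<in> - K"
    then have "0 < infdist x K"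
      using K_nonempty K_compact compact_imp_closed in_closed_iff_infdist_zero infdist_nonneg
      by (metis ComplD order_le_less)
    then obtain n where "1 / (real n + 1) < infdist x K"
      using reals_Archimedean by (metis inverse_eq_divide of_nat_Suc add.commute)
    then show "x \<in> (\<Union>n. {x. 1 / (real n + 1) \<le> infdist x K})" by (auto intro: less_imp_le)
  qed (auto simp: not_le)
  ultimately have "prob (- K) = 0" by simp
  moreover have "K \<in> events" using K_compact by (simp add: sets_\<pi> borel_compact)
  ultimately show ?thesis using prob_compl[of K] by (simp add: Compl_eq_Diff_UNIV)
qed

lemma prob_superset_K: "A \<in> sets borel \<Longrightarrow> K \<subseteq> A \<Longrightarrow> prob A = 1"
  using finite_measure_mono[of K A] prob_K prob_le_1[of A] by (simp add: sets_\<pi>)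

lemma prob_disjoint_K: "A \<in> sets borel \<Longrightarrow> A \<inter> K = {} \<Longrightarrow> prob A = 0"
  using prob_superset_K[of "- A"] prob_compl[of A] by (auto simp: sets_\<pi> Compl_eq_Diff_UNIV)

text \<open>
  In the decomposition of \<open>prob A\<close> over a cut set, only the words whose cylinder meets \<open>A\<close>
  contribute, as \<open>\<pi>\<close> is carried by \<open>K\<close>.
\<close>
lemma prob_le_sum_meeting:
  assumes "0 < \<rho>" "A \<in> sets borel"
  shows "prob A \<le> (\<Sum>v\<in>{v\<in>cutset \<rho>. \<exists>y\<in>K. word_map v y \<in> A}. weight v)"
proof -
  have meas: "word_map v -` A \<in> sets borel" if "v \<in> cutset \<rho>" for v
    using measurable_sets[OF borel_measurable_continuous_onI[OF word_map_continuous[OF cutset_words[OF that], of UNIV]]] assms(2)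
    by simp
  have "prob A = (\<Sum>v\<in>cutset \<rho>. weight v * prob (word_map v -` A))"
    by (rule measure_cutset[OF assms])
  also have "\<dots> = (\<Sum>v\<in>{v\<in>cutset \<rho>. \<exists>y\<in>K. word_map v y \<in> A}. weight v * prob (word_map v -` A))"
    using finite_cutset[OF assms(1)] meas
    by (intro sum.mono_neutral_right) (auto intro!: prob_disjoint_K)
  also have "\<dots> \<le> (\<Sum>v\<in>{v\<in>cutset \<rho>. \<exists>y\<in>K. word_map v y \<in> A}. weight v)"
    using cutset_words weight_pos by (intro sum_mono mult_left_le) (auto simp: less_imp_le)
  finally show ?thesis .
qed

lemma prob_ge_weight:
  assumes "v \<in> lists {1..M}" "A \<in> sets borel" "word_map v ` K \<subseteq> A"
  shows "weight v \<le> prob A"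
  using assms
proof (induction v arbitrary: A)
  case Nil
  then show ?case using prob_superset_K by auto
next
  case (Cons m v)
  then have m: "m \<in> {1..M}" by simp
  have "weight v \<le> prob (S m -` A)"
    using Cons S_measurable[OF m] by (intro Cons.IH) auto
  then have "weight (m # v) \<le> p m * prob (S m -` A)" using p_pos[OF m] by simp
  also have "\<dots> \<le> (\<Sum>m\<in>{1..M}. p m * prob (S m -` A))"
    using m p_pos by (intro member_le_sum) (auto simp: less_imp_le)
  also have "\<dots> = prob A" using \<pi>_sum[OF Cons.prems(1)] by simp
  finally show ?case .
qed

abbreviation "diam \<equiv> diameter K"

lemma diam_nonneg: "0 \<le> diam" and dist_le_diam: "x \<in> K \<Longrightarrow> y \<in> K \<Longrightarrow> dist x y \<le> diam"
  using diameter_ge_0 diameter_bounded_bound compact_imp_bounded[OF K_compact] by blast+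

text \<open>
  The ball contains the cylinder around \<open>x\<close> at scale \<open>\<rho> / (diam + 1)\<close>.
\<close>
lemma ex_measure_ball_ge:
  "\<exists>c>0. \<forall>x\<in>K. \<forall>\<rho>. 0 < \<rho> \<and> \<rho> < 1 \<longrightarrow> c * \<rho> powr smax \<le> prob (ball x \<rho>)"
proof (intro exI[of _ "(rmin / (diam + 1)) powr smax"] conjI ballI allI impI; (elim conjE)?)
  show "0 < (rmin / (diam + 1)) powr smax" using rmin_pos diam_nonneg by simp
  fix x \<rho> assume x: "x \<in> K" and \<rho>: "0 < \<rho>" "\<rho> < (1::real)"
  have \<rho>': "0 < \<rho> / (diam + 1)" "\<rho> / (diam + 1) \<le> 1" using \<rho> diam_nonneg by auto
  obtain v y where v: "v \<in> cutset (\<rho> / (diam + 1))" "y \<in> K" "x = word_map v y"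
    using K_cutset[OF \<rho>'(1) x] by blast
  note vw = cutset_words[OF v(1)]
  have "word_map v ` K \<subseteq> ball x \<rho>"
  proof (clarsimp simp: v(3) dist_word_map[OF vw])
    fix z assume "z \<in> K"
    have "ratio v * dist y z \<le> \<rho> / (diam + 1) * diam"
      using cutset_ratio_le[OF v(1)] dist_le_diam[OF v(2) \<open>z \<in> K\<close>] \<rho>' by (intro mult_mono) auto
    also have "\<dots> < \<rho>" using \<rho> diam_nonneg by (simp add: field_simps)
    finally show "ratio v * dist y z < \<rho>" .
  qed
  then have "weight v \<le> prob (ball x \<rho>)" by (intro prob_ge_weight vw) auto
  moreover have "(rmin / (diam + 1)) powr smax * \<rho> powr smax \<le> ratio v powr smax"
  proof -
    have "(rmin / (diam + 1)) powr smax * \<rho> powr smax = (rmin * (\<rho> / (diam + 1))) powr smax"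
      using rmin_pos diam_nonneg \<rho> by (subst powr_mult[symmetric]) auto
    also have "\<dots> \<le> ratio v powr smax"
      using cutset_ratio_ge[OF v(1) \<rho>'(2)] rmin_pos \<rho> diam_nonneg smax_nonneg
      by (intro powr_mono2 mult_nonneg_nonneg divide_nonneg_nonneg) auto
    finally show ?thesis .
  qed
  ultimately show "(rmin / (diam + 1)) powr smax * \<rho> powr smax \<le> prob (ball x \<rho>)"
    using weight_ge_powr[OF vw] by (meson order_trans)
qed

text \<open>
  Fix a ball \<open>ball z a\<close> in the open set. The points \<open>word_map v z\<close> belonging to the words counted lie
  within a multiple of \<open>\<rho>\<close> of \<open>x\<close> and, the images of that ball being disjoint, keep mutual distance at
  least \<open>a * rmin * \<rho>\<close>. After rescaling by \<open>\<rho>\<close> a packing bound independent of \<open>\<rho>\<close> and \<open>x\<close> applies.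
\<close>
lemma ex_neighbour_bound:
  fixes R :: real
  shows "\<exists>N::nat. \<forall>\<rho> x. 0 < \<rho> \<longrightarrow> \<rho> \<le> 1 \<longrightarrow>
    card {v \<in> cutset \<rho>. \<exists>y\<in>K. dist (word_map v y) x < R * \<rho>} \<le> N"
proof -
  obtain U where "U \<noteq> {}" "open U" and U': "\<forall>m\<in>{1..M}. S m ` U \<subseteq> U"
    "\<forall>l\<in>{1..M}. \<forall>m\<in>{1..M}. l \<noteq> m \<longrightarrow> S l ` U \<inter> S m ` U = {}"
    using osc unfolding open_set_condition_def by (elim exE conjE) (rule that)
  note U = U'[rule_format]
  from \<open>U \<noteq> {}\<close> \<open>open U\<close> obtain z a where a: "0 < a" "ball z a \<subseteq> U"
    by (metis ex_in_conv open_contains_ball)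
  have zU: "z \<in> U" using a by auto
  obtain D where D: "\<And>y. y \<in> K \<Longrightarrow> dist z y \<le> D"
    using compact_imp_bounded[OF K_compact] unfolding bounded_any_center[of K z] by blast
  obtain N where N: "\<And>F :: 'a set. F \<subseteq> cball 0 (D + R) \<Longrightarrow>
    (\<forall>x\<in>F. \<forall>y\<in>F. x \<noteq> y \<longrightarrow> a * rmin \<le> dist x y) \<Longrightarrow> finite F \<and> card F \<le> N"
    using separated_card_bound[of "a * rmin" "D + R"] a rmin_pos by auto
  show ?thesis
  proof (intro exI[of _ N] allI impI)
    fix \<rho> :: real and x :: 'a
    assume \<rho>: "0 < \<rho>" "\<rho> \<le> 1"
    define V where "V = {v \<in> cutset \<rho>. \<exists>y\<in>K. dist (word_map v y) x < R * \<rho>}"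
    define g where "g v = (word_map v z - x) /\<^sub>R \<rho>" for v
    have dist_g: "dist (g v) (g w) = dist (word_map v z) (word_map w z) / \<rho>" for v w
      unfolding g_def dist_norm scaleR_diff_right[symmetric] norm_scaleR
      using \<rho> by (simp add: divide_inverse mult.commute)
    have sep: "a * rmin \<le> dist (g v) (g w)" if "v \<in> V" "w \<in> V" "v \<noteq> w" for v w
    proof -
      have v: "v \<in> cutset \<rho>" and w: "w \<in> cutset \<rho>" using that by (auto simp: V_def)
      have "ball (word_map v z) (ratio v * a) \<subseteq> word_map v ` U"
        using similarity_ball[of "ratio v" "word_map v" z a] ratio_pos dist_word_map cutset_words[OF v] a(2)
        by blast
      moreover have "word_map w z \<notin> word_map v ` U"
        using cutset_disjoint[OF U v w that(3)] imageI[OF zU, of "word_map w"] by blast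
      ultimately have "ratio v * a \<le> dist (word_map v z) (word_map w z)" by force
      moreover have "rmin * \<rho> * a \<le> ratio v * a" using cutset_ratio_ge[OF v \<rho>(2)] a by simp
      ultimately show ?thesis using \<rho> by (simp add: dist_g pos_le_divide_eq ac_simps)
    qed
    have "inj_on g V"
    proof (rule inj_onI, rule ccontr)
      fix v w assume "v \<in> V" "w \<in> V" "g v = g w" "v \<noteq> w"
      then have "a * rmin \<le> 0" using sep[of v w] by simp
      then show False using a rmin_pos by (simp add: mult_le_0_iff)
    qed
    moreover have "g ` V \<subseteq> cball 0 (D + R)"
    proof clarify
      fix v assume "v \<in> V"
      then obtain y where v: "v \<in> cutset \<rho>" and y: "y \<in> K" "dist (word_map v y) x < R * \<rho>"
        by (auto simp: V_def)
      have "dist (word_map v z) (word_map v y) \<le> \<rho> * D"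
        using dist_word_map[OF cutset_words[OF v]] cutset_ratio_le[OF v] D[OF y(1)] \<rho>
        by (auto intro!: mult_mono)
      then have "dist (word_map v z) x \<le> (D + R) * \<rho>"
        using y(2) dist_triangle[of "word_map v z" x "word_map v y"] by (simp add: algebra_simps)
      moreover have "norm (g v) = dist (word_map v z) x / \<rho>"
        unfolding g_def norm_scaleR dist_norm using \<rho> by (simp add: divide_inverse mult.commute)
      ultimately show "g v \<in> cball 0 (D + R)"
        using \<rho> by (simp add: pos_divide_le_eq)
    qed
    ultimately show "card V \<le> N"
      using N[of "g ` V"] sep by (auto simp: card_image)
  qed
qed

lemma ex_measure_ball_le:
  "\<exists>C>0. \<forall>x. \<forall>\<rho>. 0 < \<rho> \<and> \<rho> < 1 \<longrightarrow> prob (ball x \<rho>) \<le> C * \<rho> powr smin"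
proof -
  obtain N where N: "\<And>\<rho> x. 0 < \<rho> \<Longrightarrow> \<rho> \<le> 1 \<Longrightarrow>
      card {v \<in> cutset \<rho>. \<exists>y\<in>K. dist (word_map v y) x < 1 * \<rho>} \<le> N"
    using ex_neighbour_bound[of 1] by auto
  show ?thesis
  proof (intro exI[of _ "real N + 1"] conjI allI impI; (elim conjE)?)
    fix x :: 'a and \<rho> :: real assume \<rho>: "0 < \<rho>" "\<rho> < 1"
    define V where "V = {v \<in> cutset \<rho>. \<exists>y\<in>K. dist (word_map v y) x < 1 * \<rho>}"
    have card: "card V \<le> N" using N[of \<rho> x] \<rho> unfolding V_def by linarith
    have "prob (ball x \<rho>) \<le> (\<Sum>v\<in>V. weight v)"
      using prob_le_sum_meeting[OF \<rho>(1), of "ball x \<rho>"] by (simp add: V_def dist_commute)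
    also have "\<dots> \<le> (\<Sum>v\<in>V. \<rho> powr smin)"
    proof (rule sum_mono)
      fix v assume "v \<in> V"
      then have v: "v \<in> cutset \<rho>" by (simp add: V_def)
      have "weight v \<le> ratio v powr smin" by (rule weight_le_powr[OF cutset_words[OF v]])
      also have "\<dots> \<le> \<rho> powr smin"
        using cutset_ratio_le[OF v] ratio_pos[OF cutset_words[OF v]] smin_nonneg
        by (intro powr_mono2) auto
      finally show "weight v \<le> \<rho> powr smin" .
    qed
    also have "\<dots> = real (card V) * \<rho> powr smin" by simp
    also have "\<dots> \<le> (real N + 1) * \<rho> powr smin"
      using card by (intro mult_right_mono) auto
    finally show "prob (ball x \<rho>) \<le> (real N + 1) * \<rho> powr smin" .
  qed simp
qed

section \<open>Points with thin and with fat balls\<close>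

definition "neighbours w =
  {v \<in> cutset (ratio w). \<exists>x\<in>K. \<exists>y\<in>K. dist (word_map v y) (word_map w x) < ratio w}"

lemma finite_neighbours: "w \<in> lists {1..M} \<Longrightarrow> finite (neighbours w)"
  unfolding neighbours_def using finite_cutset[OF ratio_pos] by simp

lemma ex_card_neighbours_bound: "\<exists>N. \<forall>w\<in>lists {1..M}. card (neighbours w) \<le> N"
proof -
  obtain x\<^sub>0 where x\<^sub>0: "x\<^sub>0 \<in> K" using K_nonempty by blast
  obtain N where N: "\<forall>\<rho> x. 0 < \<rho> \<longrightarrow> \<rho> \<le> 1 \<longrightarrow>
      card {v \<in> cutset \<rho>. \<exists>y\<in>K. dist (word_map v y) x < (1 + diam) * \<rho>} \<le> N"
    using ex_neighbour_bound[of "1 + diam"] by blast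
  have "card (neighbours w) \<le> N" if w: "w \<in> lists {1..M}" for w
  proof -
    let ?V = "{v \<in> cutset (ratio w). \<exists>y\<in>K. dist (word_map v y) (word_map w x\<^sub>0) < (1 + diam) * ratio w}"
    have "neighbours w \<subseteq> ?V"
    proof
      fix v assume "v \<in> neighbours w"
      then obtain x y where v: "v \<in> cutset (ratio w)" and xy: "x \<in> K" "y \<in> K"
        "dist (word_map v y) (word_map w x) < ratio w"
        by (auto simp: neighbours_def)
      have "dist (word_map w x) (word_map w x\<^sub>0) \<le> ratio w * diam"
        using dist_word_map[OF w] dist_le_diam[OF xy(1) x\<^sub>0] ratio_pos[OF w] by simp
      then have "dist (word_map v y) (word_map w x\<^sub>0) < (1 + diam) * ratio w"
        using xy(3) dist_triangle[of "word_map v y" "word_map w x\<^sub>0" "word_map w x"]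
        by (simp add: algebra_simps)
      then show "v \<in> ?V" using v xy(2) by blast
    qed
    then have "card (neighbours w) \<le> card ?V"
      using finite_cutset[OF ratio_pos[OF w]] by (intro card_mono) auto
    also have "\<dots> \<le> N" using N ratio_pos[OF w] ratio_le_1[OF w] by blast
    finally show ?thesis .
  qed
  then show ?thesis by blast
qed

text \<open>
  Schief's maximality argument. If \<open>v\<close> is a neighbour of \<open>w\<close> then \<open>u @ v\<close> is a neighbour of \<open>u @ w\<close>, so
  when \<open>w\<close> has the maximal number of neighbours there are no others. All cylinders that meet the
  ball then come from words with prefix \<open>u\<close>, and these have total mass at most \<open>weight u\<close>.
\<close>
lemma ex_isolated_word:
  "\<exists>w\<in>lists {1..M}. \<forall>u\<in>lists {1..M}. \<forall>x\<in>K.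
     prob (ball (word_map (u @ w) x) (ratio (u @ w))) \<le> weight u"
proof -
  obtain N where N: "\<forall>w. w \<in> lists {1..M} \<longrightarrow> card (neighbours w) \<le> N"
    using ex_card_neighbours_bound by blast
  obtain w where w: "w \<in> lists {1..M}"
    and max: "\<And>u. u \<in> lists {1..M} \<Longrightarrow> card (neighbours u) \<le> card (neighbours w)"
    using ex_has_greatest_nat[of "\<lambda>w. w \<in> lists {1..M}" "[]" "\<lambda>w. card (neighbours w)" "Suc N"] N
    by (auto simp: less_Suc_eq_le)
  have "prob (ball (word_map (u @ w) x) (ratio (u @ w))) \<le> weight u"
    if u: "u \<in> lists {1..M}" and x: "x \<in> K" for u x
  proof -
    have uw: "u @ w \<in> lists {1..M}" using u w by simp
    have "(@) u ` neighbours w \<subseteq> neighbours (u @ w)"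
    proof clarify
      fix v assume "v \<in> neighbours w"
      then obtain x y where v: "v \<in> cutset (ratio w)" and xy: "x \<in> K" "y \<in> K"
        "dist (word_map v y) (word_map w x) < ratio w"
        by (auto simp: neighbours_def)
      have "u @ v \<in> cutset (ratio (u @ w))"
        using cutset_append[OF v ratio_le_1[OF w] u] by simp
      moreover have "dist (word_map (u @ v) y) (word_map (u @ w) x) < ratio (u @ w)"
        using xy(3) ratio_pos[OF u] by (simp add: word_map_append dist_word_map[OF u])
      ultimately show "u @ v \<in> neighbours (u @ w)" using xy by (auto simp: neighbours_def)
    qed
    moreover have "card (neighbours (u @ w)) \<le> card ((@) u ` neighbours w)"
      using max[OF uw] by (simp add: card_image inj_on_def)
    ultimately have eq: "(@) u ` neighbours w = neighbours (u @ w)"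
      by (intro card_seteq finite_neighbours uw)
    let ?B = "ball (word_map (u @ w) x) (ratio (u @ w))"
    have "prob ?B \<le> (\<Sum>v\<in>{v\<in>cutset (ratio (u @ w)). \<exists>y\<in>K. word_map v y \<in> ?B}. weight v)"
      by (rule prob_le_sum_meeting[OF ratio_pos[OF uw]]) simp
    also have "\<dots> \<le> (\<Sum>v\<in>neighbours (u @ w). weight v)"
    proof (rule sum_mono2[OF finite_neighbours[OF uw]])
      show "{v\<in>cutset (ratio (u @ w)). \<exists>y\<in>K. word_map v y \<in> ?B} \<subseteq> neighbours (u @ w)"
        using x unfolding neighbours_def mem_ball by (auto simp: dist_commute)
      show "0 \<le> weight v" if "v \<in> neighbours (u @ w) - {v\<in>cutset (ratio (u @ w)). \<exists>y\<in>K. word_map v y \<in> ?B}" for v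
      proof -
        have "v \<in> cutset (ratio (u @ w))" using that unfolding neighbours_def by blast
        then show ?thesis using weight_pos[OF cutset_words] by (simp add: less_imp_le)
      qed
    qed
    also have "\<dots> = weight u * (\<Sum>v\<in>neighbours w. weight v)"
      unfolding eq[symmetric] by (subst sum.reindex) (auto simp: inj_on_def sum_distrib_left)
    also have "\<dots> \<le> weight u * (\<Sum>v\<in>cutset (ratio w). weight v)"
    proof (intro mult_left_mono sum_mono2 finite_cutset ratio_pos w)
      show "0 \<le> weight u" using weight_pos[OF u] by simp
      show "neighbours w \<subseteq> cutset (ratio w)" unfolding neighbours_def by blast
      show "0 \<le> weight v" if "v \<in> cutset (ratio w) - neighbours w" for v
        using that weight_pos[OF cutset_words] by (auto simp: less_imp_le)
    qed
    also have "\<dots> = weight u" using sum_weight_cutset[OF ratio_pos[OF w]] by simp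
    finally show ?thesis .
  qed
  then show ?thesis using w by blast
qed

text \<open>
  The single scale \<open>\<rho>\<close> serves all images of \<open>x\<close> at once. This uniformity in \<open>u\<close> is what later provides
  a common scale for finitely many points of the orbit of \<open>x\<close>.
\<close>
definition thin_at :: "real \<Rightarrow> 'a \<Rightarrow> bool" where
  "thin_at t x \<longleftrightarrow> (\<exists>\<rho>. 0 < \<rho> \<and> \<rho> < t \<and>
     (\<forall>u\<in>lists {1..M}. prob (ball (word_map u x) (ratio u * \<rho>)) \<le> \<rho> powr (smax - t)))"

definition fat_at :: "real \<Rightarrow> 'a \<Rightarrow> bool" where
  "fat_at t x \<longleftrightarrow> (\<exists>\<rho>. 0 < \<rho> \<and> \<rho> < t \<and>
     (\<forall>u\<in>lists {1..M}. weight u * \<rho> powr (smin + t) \<le> prob (ball (word_map u x) (ratio u * \<rho>))))"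

text \<open>
  Append a long run of a letter \<open>m\<close> with \<open>p m = r m powr smax\<close>, followed by an isolated word \<open>w\<close>. The ball
  then has mass at most \<open>p m ^ n\<close>; its radius is \<open>r m ^ n\<close> times a factor \<open>c\<close> independent of
  \<open>n\<close>, which the tolerance \<open>t\<close> absorbs once \<open>n\<close> is large.
\<close>
lemma ex_thin_extension:
  assumes \<sigma>: "\<sigma> \<in> lists {1..M}" and t: "0 < t"
  shows "\<exists>\<tau>\<in>lists {1..M}. \<forall>x\<in>K. thin_at t (word_map (\<sigma> @ \<tau>) x)"
proof -
  obtain w where w: "w \<in> lists {1..M}" and isolated: "\<And>u x. u \<in> lists {1..M} \<Longrightarrow> x \<in> K \<Longrightarrow>
     prob (ball (word_map (u @ w) x) (ratio (u @ w))) \<le> weight u"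
    using ex_isolated_word by blast
  obtain m where m: "m \<in> {1..M}" "p m = r m powr smax" using ex_max_letter by blast
  define c where "c = ratio \<sigma> * ratio w"
  have c: "0 < c" using ratio_pos[OF \<sigma>] ratio_pos[OF w] by (simp add: c_def)
  obtain n where n: "c * r m ^ n < t" "(c * r m ^ n) powr t \<le> c powr smax"
    using ex_geometric_small[OF c, of "c powr smax" "r m" t t] c r_pos[OF m(1)] r_less_1[OF m(1)] t
    by auto
  define \<tau> where "\<tau> = replicate n m @ w"
  define \<rho> where "\<rho> = c * r m ^ n"
  have \<rho>: "0 < \<rho>" using c r_pos[OF m(1)] by (simp add: \<rho>_def)
  have \<tau>: "\<tau> \<in> lists {1..M}" using w m by (auto simp: \<tau>_def)
  have pn: "p m ^ n \<le> \<rho> powr (smax - t)"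
  proof -
    have "p m ^ n = (r m ^ n) powr smax"
      unfolding m(2) using r_pos[OF m(1)] by (simp add: powr_powr mult.commute flip: powr_realpow)
    also have "\<dots> = \<rho> powr smax / c powr smax"
      using c r_pos[OF m(1)] by (simp add: \<rho>_def powr_mult)
    also have "\<dots> \<le> \<rho> powr smax / \<rho> powr t"
      using n(2)[folded \<rho>_def] \<rho> c by (intro divide_left_mono mult_pos_pos) auto
    finally show ?thesis by (simp add: powr_diff)
  qed
  have "thin_at t (word_map (\<sigma> @ \<tau>) x)" if x: "x \<in> K" for x
    unfolding thin_at_def
  proof (intro exI[of _ \<rho>] conjI ballI \<rho>)
    show "\<rho> < t" using n by (simp add: \<rho>_def)
    fix u assume u: "u \<in> lists {1..M}"
    have v: "u @ \<sigma> @ replicate n m \<in> lists {1..M}" using u \<sigma> m by auto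
    have "prob (ball (word_map u (word_map (\<sigma> @ \<tau>) x)) (ratio u * \<rho>)) \<le> weight (u @ \<sigma> @ replicate n m)"
      using isolated[OF v x] by (simp add: \<tau>_def word_map_append \<rho>_def c_def ac_simps)
    also have "\<dots> \<le> p m ^ n"
      using weight_le_1[OF u] weight_pos[OF u] weight_le_1[OF \<sigma>] weight_pos[OF \<sigma>] p_pos[OF m(1)]
      by (simp add: mult_le_one mult_left_le_one_le flip: mult.assoc)
    finally show "prob (ball (word_map u (word_map (\<sigma> @ \<tau>) x)) (ratio u * \<rho>)) \<le> \<rho> powr (smax - t)"
      using pn by linarith
  qed
  then show ?thesis using \<tau> by blast
qed

text \<open>
  Append a long run of a letter \<open>m\<close> with \<open>p m = r m powr smin\<close>. A ball around
  a point of the resulting cylinder with radius beyond its diameter has at least its mass.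
\<close>
lemma ex_fat_extension:
  assumes \<sigma>: "\<sigma> \<in> lists {1..M}" and t: "0 < t"
  shows "\<exists>\<tau>\<in>lists {1..M}. \<forall>x\<in>K. fat_at t (word_map (\<sigma> @ \<tau>) x)"
proof -
  obtain m where m: "m \<in> {1..M}" "p m = r m powr smin" using ex_min_letter by blast
  define c where "c = (diam + 1) * ratio \<sigma>"
  have c: "0 < c" using ratio_pos[OF \<sigma>] diam_nonneg by (simp add: c_def)
  obtain n where n: "c * r m ^ n < t" "(c * r m ^ n) powr t \<le> weight \<sigma> / c powr smin"
    using ex_geometric_small[OF c, of "weight \<sigma> / c powr smin" "r m" t t] c weight_pos[OF \<sigma>]
      r_pos[OF m(1)] r_less_1[OF m(1)] t
    by auto
  define \<tau> where "\<tau> = replicate n m"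
  define \<rho> where "\<rho> = c * r m ^ n"
  have \<rho>: "0 < \<rho>" using c r_pos[OF m(1)] by (simp add: \<rho>_def)
  have ratio: "(diam + 1) * ratio (\<sigma> @ \<tau>) = \<rho>" by (simp add: \<tau>_def \<rho>_def c_def)
  have \<tau>: "\<tau> \<in> lists {1..M}" using m by (auto simp: \<tau>_def)
  have pn: "\<rho> powr (smin + t) \<le> weight (\<sigma> @ \<tau>)"
  proof -
    have "\<rho> powr (smin + t) \<le> \<rho> powr smin * (weight \<sigma> / c powr smin)"
      unfolding powr_add \<rho>_def by (rule mult_left_mono[OF n(2)]) simp
    also have "\<dots> = weight \<sigma> * (r m ^ n) powr smin"
      using c r_pos[OF m(1)] by (simp add: \<rho>_def powr_mult)
    also have "(r m ^ n) powr smin = p m ^ n"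
      unfolding m(2) using r_pos[OF m(1)] by (simp add: powr_powr mult.commute flip: powr_realpow)
    finally show ?thesis by (simp add: \<tau>_def)
  qed
  have "fat_at t (word_map (\<sigma> @ \<tau>) x)" if x: "x \<in> K" for x
    unfolding fat_at_def
  proof (intro exI[of _ \<rho>] conjI ballI \<rho>)
    show "\<rho> < t" using n by (simp add: \<rho>_def)
    fix u assume u: "u \<in> lists {1..M}"
    have v: "u @ \<sigma> @ \<tau> \<in> lists {1..M}" using u \<sigma> \<tau> by auto
    have "word_map (u @ \<sigma> @ \<tau>) ` K \<subseteq> ball (word_map (u @ \<sigma> @ \<tau>) x) (ratio u * \<rho>)"
    proof clarify
      fix y assume y: "y \<in> K"
      have "ratio (u @ \<sigma> @ \<tau>) * dist x y \<le> ratio (u @ \<sigma> @ \<tau>) * diam"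
        using dist_le_diam[OF x y] less_imp_le[OF ratio_pos[OF v]] by (rule mult_left_mono)
      also have "\<dots> < ratio (u @ \<sigma> @ \<tau>) * (diam + 1)"
        using ratio_pos[OF v] by (intro mult_strict_left_mono) auto
      also have "\<dots> = ratio u * \<rho>" by (simp flip: ratio)
      finally show "word_map (u @ \<sigma> @ \<tau>) y \<in> ball (word_map (u @ \<sigma> @ \<tau>) x) (ratio u * \<rho>)"
        by (simp only: mem_ball dist_word_map[OF v])
    qed
    then have "weight (u @ \<sigma> @ \<tau>) \<le> prob (ball (word_map (u @ \<sigma> @ \<tau>) x) (ratio u * \<rho>))"
      by (intro prob_ge_weight v) auto
    moreover have "weight u * \<rho> powr (smin + t) \<le> weight (u @ \<sigma> @ \<tau>)"
      using pn weight_pos[OF u] by simp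
    ultimately show "weight u * \<rho> powr (smin + t) \<le> prob (ball (word_map u (word_map (\<sigma> @ \<tau>) x)) (ratio u * \<rho>))"
      by (simp add: word_map_append)
  qed
  then show ?thesis using \<tau> by blast
qed

text \<open>
  The two kinds of extension are applied alternately with tolerances tending to 0; the resulting
  cylinders decrease, and a point in their intersection inherits every property that
  some cylinder guarantees for all of its points.
\<close>
lemma ex_thin_and_fat_point: "\<exists>x\<in>K. \<forall>n::nat. thin_at (1 / Suc n) x \<and> fat_at (1 / Suc n) x"
proof -
  define good where "good n v \<longleftrightarrow> v \<in> lists {1..M} \<and>
    (\<forall>x\<in>K. thin_at (1 / Suc n) (word_map v x) \<and> fat_at (1 / Suc n) (word_map v x))" for n v
  have step: "\<exists>\<tau>. \<tau> \<in> lists {1..M} \<and> good n (\<sigma> @ \<tau>)" if \<sigma>: "\<sigma> \<in> lists {1..M}" for \<sigma> n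
  proof -
    obtain \<tau> where \<tau>: "\<tau> \<in> lists {1..M}" "\<And>x. x \<in> K \<Longrightarrow> thin_at (1 / Suc n) (word_map (\<sigma> @ \<tau>) x)"
      using ex_thin_extension[OF \<sigma>, of "1 / Suc n"] by auto
    have \<sigma>\<tau>: "\<sigma> @ \<tau> \<in> lists {1..M}" using \<sigma> \<tau> by simp
    obtain \<tau>' where \<tau>': "\<tau>' \<in> lists {1..M}"
      "\<And>x. x \<in> K \<Longrightarrow> fat_at (1 / Suc n) (word_map ((\<sigma> @ \<tau>) @ \<tau>') x)"
      using ex_fat_extension[OF \<sigma>\<tau>, of "1 / Suc n"] by auto
    have "thin_at (1 / Suc n) (word_map (\<sigma> @ \<tau> @ \<tau>') x)" if "x \<in> K" for x
      using \<tau>(2)[OF word_map_K[OF \<tau>'(1) that]] by (simp add: word_map_append)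
    then show ?thesis
      using \<sigma> \<tau> \<tau>' by (intro exI[of _ "\<tau> @ \<tau>'"]) (auto simp: good_def)
  qed
  have "\<exists>f. \<forall>n. good n (f n) \<and> (\<exists>\<tau>\<in>lists {1..M}. f (Suc n) = f n @ \<tau>)"
  proof (rule dependent_nat_choice)
    show "\<exists>v. good 0 v" using step[of "[]" 0] by auto
    show "\<exists>v. good (Suc n) v \<and> (\<exists>\<tau>\<in>lists {1..M}. v = \<sigma> @ \<tau>)" if "good n \<sigma>" for n \<sigma>
      using step[of \<sigma> "Suc n"] that unfolding good_def by blast
  qed
  then obtain f where f: "\<And>n. good n (f n)" "\<And>n. \<exists>\<tau>\<in>lists {1..M}. f (Suc n) = f n @ \<tau>"
    by blast
  have fw: "f n \<in> lists {1..M}" for n using f(1) by (simp add: good_def)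
  have "(\<Inter>n. word_map (f n) ` K) \<noteq> {}"
  proof (rule compact_nest)
    show "compact (word_map (f n) ` K)" for n
      by (intro compact_continuous_image word_map_continuous fw K_compact)
    show "word_map (f n) ` K \<noteq> {}" for n using K_nonempty by simp
    show "word_map (f n) ` K \<subseteq> word_map (f m) ` K" if "m \<le> n" for m n
    proof (rule lift_Suc_antimono_le[OF _ that])
      fix k
      obtain \<tau> where \<tau>: "\<tau> \<in> lists {1..M}" "f (Suc k) = f k @ \<tau>" using f(2) by blast
      show "word_map (f (Suc k)) ` K \<subseteq> word_map (f k) ` K"
        using word_map_K[OF \<tau>(1)] by (auto simp: \<tau>(2) word_map_append)
    qed
  qed
  then obtain x where x: "\<And>n. x \<in> word_map (f n) ` K" by blast
  have "thin_at (1 / Suc n) x \<and> fat_at (1 / Suc n) x" for n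
    using x[of n] f(1)[of n] unfolding good_def by blast
  moreover have "x \<in> K" using x[of 0] word_map_K[OF fw] by blast
  ultimately show ?thesis by blast
qed

lemma orbit_dense:
  assumes "x \<in> K"
  shows "K \<subseteq> closure ((\<lambda>u. word_map u x) ` lists {1..M})"
proof
  fix y assume y: "y \<in> K"
  show "y \<in> closure ((\<lambda>u. word_map u x) ` lists {1..M})"
    unfolding closure_approachable
  proof (intro allI impI)
    fix e :: real assume e: "0 < e"
    then have "0 < e / (diam + 1)" using diam_nonneg by simp
    then obtain v z where v: "v \<in> cutset (e / (diam + 1))" "z \<in> K" "y = word_map v z"
      using K_cutset y by blast
    have "dist (word_map v x) y = ratio v * dist x z"
      using v cutset_words by (simp add: dist_word_map)
    also have "\<dots> \<le> e / (diam + 1) * diam"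
      using cutset_ratio_le[OF v(1)] dist_le_diam[OF assms v(2)] e diam_nonneg by (intro mult_mono) auto
    also have "\<dots> < e" using e diam_nonneg by (simp add: field_simps)
    finally show "\<exists>y'\<in>(\<lambda>u. word_map u x) ` lists {1..M}. dist y' y < e"
      using cutset_words[OF v(1)] by blast
  qed
qed

lemma ex_small_reciprocal:
  assumes "0 < (\<delta>::real)"
  shows "\<exists>n. 1 / real (Suc n) < \<delta>"
  using reals_Archimedean[OF assms] by (simp add: inverse_eq_divide)

text \<open>
  The scale of \<open>thin_at\<close> is multiplied by the smallest ratio \<open>\<kappa>\<close> of the finitely many words, so that
  balls only shrink; half of the tolerance \<open>t\<close> pays for the constant \<open>\<kappa> powr a\<close>.
\<close>
lemma thin_scale:
  assumes thin: "\<And>n::nat. thin_at (1 / Suc n) x" and V: "finite V" "V \<subseteq> lists {1..M}"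
    and "0 < t" "0 < \<delta>"
  shows "\<exists>\<rho>. 0 < \<rho> \<and> \<rho> < \<delta> \<and> (\<forall>y\<in>(\<lambda>u. word_map u x) ` V. prob (ball y \<rho>) \<le> \<rho> powr (smax - t))"
proof -
  define \<kappa> where "\<kappa> = Min (insert 1 (ratio ` V))"
  have \<kappa>: "0 < \<kappa>" "\<kappa> \<le> 1" and \<kappa>_le: "\<And>u. u \<in> V \<Longrightarrow> \<kappa> \<le> ratio u"
    using V(1) ratio_pos[OF subsetD[OF V(2)]] by (auto simp: \<kappa>_def)
  define a where "a = smax - t/2"
  define \<delta>' where "\<delta>' = Min {\<delta>, 1, t/2, (\<kappa> powr a) powr (1/(t/2))}"
  have \<delta>'_le: "\<delta>' \<le> \<delta>" "\<delta>' \<le> 1" "\<delta>' \<le> t/2" "\<delta>' \<le> (\<kappa> powr a) powr (1/(t/2))"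
    by (auto simp: \<delta>'_def)
  have "0 < \<delta>'" using assms(4,5) \<kappa> by (simp add: \<delta>'_def)
  then obtain n where n: "1 / real (Suc n) < \<delta>'" using ex_small_reciprocal by blast
  obtain \<sigma> where \<sigma>: "0 < \<sigma>" "\<sigma> < 1 / Suc n" and
    le: "\<And>u. u \<in> lists {1..M} \<Longrightarrow> prob (ball (word_map u x) (ratio u * \<sigma>)) \<le> \<sigma> powr (smax - 1 / Suc n)"
    using thin[of n] unfolding thin_at_def by blast
  have \<sigma>': "\<sigma> < \<delta>" "\<sigma> < 1" "1 / Suc n < t/2" "\<sigma> < (\<kappa> powr a) powr (1/(t/2))"
    using n \<sigma> \<delta>'_le by linarith+
  have \<kappa>\<sigma>: "\<kappa> * \<sigma> \<le> \<sigma>" using \<kappa> \<sigma> by simp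
  show ?thesis
  proof (intro exI[of _ "\<kappa> * \<sigma>"] conjI ballI; (elim imageE)?)
    show "0 < \<kappa> * \<sigma>" using \<kappa> \<sigma> by simp
    show "\<kappa> * \<sigma> < \<delta>" using \<kappa>\<sigma> \<sigma>' by simp
    fix y u assume y: "y = word_map u x" and u: "u \<in> V"
    have "prob (ball y (\<kappa> * \<sigma>)) \<le> prob (ball y (ratio u * \<sigma>))"
      using \<kappa>_le[OF u] \<sigma> by (intro finite_measure_mono subset_ball) (auto simp: sets_\<pi>)
    also have "\<dots> \<le> \<sigma> powr (smax - 1 / Suc n)" unfolding y using le u V(2) by blast
    also have "\<dots> \<le> \<sigma> powr a" using \<sigma> \<sigma>' by (intro powr_mono') (auto simp: a_def)
    also have "\<dots> = (\<kappa> * \<sigma>) powr a / \<kappa> powr a" using \<kappa> \<sigma> by (simp add: powr_mult)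
    also have "\<dots> \<le> (\<kappa> * \<sigma>) powr a / (\<kappa> * \<sigma>) powr (t/2)"
    proof (rule divide_left_mono)
      show "(\<kappa> * \<sigma>) powr (t/2) \<le> \<kappa> powr a"
        using order.strict_trans1[OF \<kappa>\<sigma> \<sigma>'(4)] \<sigma> \<kappa> assms(4) by (intro powr_le_of_small) auto
    qed (use \<kappa> \<sigma> in auto)
    also have "\<dots> = (\<kappa> * \<sigma>) powr (smax - t)"
      by (simp add: a_def flip: powr_diff)
    finally show "prob (ball y (\<kappa> * \<sigma>)) \<le> (\<kappa> * \<sigma>) powr (smax - t)" .
  qed
qed

text \<open>
  Here balls may only grow, so the scale of \<open>fat_at\<close> is kept, and half of the tolerance pays for the smallest
  of the weights.
\<close>
lemma fat_scale:
  assumes fat: "\<And>n::nat. fat_at (1 / Suc n) x" and V: "finite V" "V \<subseteq> lists {1..M}"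
    and "0 < t" "0 < \<delta>"
  shows "\<exists>\<rho>. 0 < \<rho> \<and> \<rho> < \<delta> \<and> (\<forall>y\<in>(\<lambda>u. word_map u x) ` V. \<rho> powr (smin + t) \<le> prob (ball y \<rho>))"
proof -
  define \<kappa> where "\<kappa> = Min (insert 1 (weight ` V))"
  have \<kappa>: "0 < \<kappa>" and \<kappa>_le: "\<And>u. u \<in> V \<Longrightarrow> \<kappa> \<le> weight u"
    using V(1) weight_pos[OF subsetD[OF V(2)]] by (auto simp: \<kappa>_def)
  define \<delta>' where "\<delta>' = Min {\<delta>, 1, t/2, \<kappa> powr (1/(t/2))}"
  have \<delta>'_le: "\<delta>' \<le> \<delta>" "\<delta>' \<le> 1" "\<delta>' \<le> t/2" "\<delta>' \<le> \<kappa> powr (1/(t/2))"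
    by (auto simp: \<delta>'_def)
  have "0 < \<delta>'" using assms(4,5) \<kappa> by (simp add: \<delta>'_def)
  then obtain n where n: "1 / real (Suc n) < \<delta>'" using ex_small_reciprocal by blast
  obtain \<sigma> where \<sigma>: "0 < \<sigma>" "\<sigma> < 1 / Suc n" and
    ge: "\<And>u. u \<in> lists {1..M} \<Longrightarrow> weight u * \<sigma> powr (smin + 1 / Suc n) \<le> prob (ball (word_map u x) (ratio u * \<sigma>))"
    using fat[of n] unfolding fat_at_def by blast
  have \<sigma>': "\<sigma> < \<delta>" "\<sigma> < 1" "1 / Suc n < t/2" "\<sigma> < \<kappa> powr (1/(t/2))"
    using n \<sigma> \<delta>'_le by linarith+
  show ?thesis
  proof (intro exI[of _ \<sigma>] conjI ballI \<sigma> \<sigma>'; elim imageE)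
    fix y u assume y: "y = word_map u x" and u: "u \<in> V"
    have uw: "u \<in> lists {1..M}" using u V by blast
    have "\<sigma> powr (smin + t) = \<sigma> powr (t/2) * \<sigma> powr (smin + t/2)"
      by (simp add: add.commute flip: powr_add)
    also have "\<dots> \<le> weight u * \<sigma> powr (smin + 1 / Suc n)"
    proof (rule mult_mono)
      have "\<sigma> powr (t/2) \<le> \<kappa>" using \<sigma> \<sigma>' \<kappa> assms(4) by (intro powr_le_of_small) auto
      then show "\<sigma> powr (t/2) \<le> weight u" using \<kappa>_le[OF u] by linarith
      show "\<sigma> powr (smin + t/2) \<le> \<sigma> powr (smin + 1 / Suc n)"
        using \<sigma> \<sigma>' by (intro powr_mono') auto
    qed (use weight_pos[OF uw] in auto)
    also have "\<dots> \<le> prob (ball y (ratio u * \<sigma>))" unfolding y by (rule ge[OF uw])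
    also have "\<dots> \<le> prob (ball y \<sigma>)"
      using ratio_le_1[OF uw] \<sigma> by (intro finite_measure_mono subset_ball) (auto simp: sets_\<pi>)
    finally show "\<sigma> powr (smin + t) \<le> prob (ball y \<sigma>)" .
  qed
qed

section \<open>Box dimensions of typical measures\<close>

text \<open>
  The flag merges the requirements for thin and for fat balls into one family, so that both are
  covered by one application of \<open>typically_finitely_coverable\<close>.
\<close>
definition efficient_cover :: "bool \<Rightarrow> real \<Rightarrow> 'a set \<Rightarrow> real \<Rightarrow> bool" where
  "efficient_cover thin t F \<rho> \<longleftrightarrow> \<rho> < t \<and> real (card F) \<le> \<rho> powr (- t) \<and>
     (\<forall>y\<in>F. if thin then prob (ball y \<rho>) \<le> \<rho> powr (smax - t)
            else \<rho> powr (smin + t) \<le> prob (ball y \<rho>))"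

lemma efficient_cover_mono:
  assumes "0 < \<rho>" "s \<le> 1" "s \<le> t" "efficient_cover thin s F \<rho>"
  shows "efficient_cover thin t F \<rho>"
proof -
  have "\<rho> powr (- s) \<le> \<rho> powr (- t)" "\<rho> powr (smax - s) \<le> \<rho> powr (smax - t)"
    "\<rho> powr (smin + t) \<le> \<rho> powr (smin + s)"
    using assms by (auto simp: efficient_cover_def intro!: powr_mono')
  then show ?thesis
    using assms unfolding efficient_cover_def by (cases thin) (auto intro: order_trans)
qed

lemma ex_efficient_scale:
  assumes x: "\<And>n::nat. thin_at (1 / Suc n) x \<and> fat_at (1 / Suc n) x"
    and F: "finite F" "F \<subseteq> (\<lambda>u. word_map u x) ` lists {1..M}" and t: "0 < t"
  shows "\<exists>\<rho>>0. efficient_cover thin t F \<rho>"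
proof -
  obtain V where V: "V \<subseteq> lists {1..M}" "finite V" "F = (\<lambda>u. word_map u x) ` V"
    using finite_subset_image[OF F] by blast
  \<comment> \<open>Adding 1 to the cardinality covers the case of an empty \<open>F\<close>.\<close>
  define c where "c = 1 / (real (card F) + 1)"
  define \<delta> where "\<delta> = min t (c powr (1/t))"
  have c: "0 < c" and \<delta>: "0 < \<delta>" using t by (auto simp: c_def \<delta>_def)
  have card: "real (card F) \<le> \<rho> powr (- t)" if "0 < \<rho>" "\<rho> < \<delta>" for \<rho>
  proof -
    have "\<rho> powr t \<le> c" using that t c by (intro powr_le_of_small) (auto simp: \<delta>_def)
    then have "1 / c \<le> 1 / \<rho> powr t" using that by (intro divide_left_mono) (auto simp: c)
    then show ?thesis by (simp add: c_def powr_minus_divide)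
  qed
  show ?thesis
  proof (cases thin)
    case True
    obtain \<rho> where "0 < \<rho>" "\<rho> < \<delta>" "\<forall>y\<in>F. prob (ball y \<rho>) \<le> \<rho> powr (smax - t)"
      using thin_scale[OF _ V(2,1) t \<delta>, of x] x unfolding V(3) by blast
    then show ?thesis
      using card[of \<rho>] True by (auto simp: efficient_cover_def \<delta>_def)
  next
    case False
    obtain \<rho> where "0 < \<rho>" "\<rho> < \<delta>" "\<forall>y\<in>F. \<rho> powr (smin + t) \<le> prob (ball y \<rho>)"
      using fat_scale[OF _ V(2,1) t \<delta>, of x] x unfolding V(3) by blast
    then show ?thesis
      using card[of \<rho>] False by (auto simp: efficient_cover_def \<delta>_def)
  qed
qed

text \<open>
  The criterion for typical behaviour, applied to the orbit of a point that is both thin and fat.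
  Its countably many conditions are the pairs of a flag and a tolerance \<open>1 / Suc n\<close>.
\<close>
lemma typically_efficiently_covered:
  "typically (weak_topology_on K) (\<lambda>\<mu>. \<forall>\<eta>>0. \<exists>E\<in>sets \<mu>. measure \<mu> E > 1 - \<eta> \<and>
     (\<forall>thin. \<forall>t>0. \<exists>F \<rho>. finite F \<and> F \<subseteq> K \<and> 0 < \<rho> \<and>
        efficient_cover thin t F \<rho> \<and> E \<subseteq> (\<Union>x\<in>F. ball x \<rho>)))"
proof -
  obtain x where x: "x \<in> K" "\<And>n::nat. thin_at (1 / Suc n) x \<and> fat_at (1 / Suc n) x"
    using ex_thin_and_fat_point by blast
  define G where "G = (\<lambda>u. word_map u x) ` lists {1..M}"
  define R where "R k F \<rho> = (case from_nat k of (thin, n) \<Rightarrow> efficient_cover thin (1 / Suc n) F \<rho>)"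
    for k F \<rho>
  have "typically (weak_topology_on K) (\<lambda>\<mu>. \<forall>\<eta>>0. \<exists>E\<in>sets \<mu>. measure \<mu> E > 1 - \<eta> \<and>
    (\<forall>k. \<exists>F \<rho>. finite F \<and> F \<subseteq> K \<and> 0 < \<rho> \<and> R k F \<rho> \<and> E \<subseteq> (\<Union>x\<in>F. ball x \<rho>)))"
  proof (rule typically_finitely_coverable[OF K_compact])
    show "G \<subseteq> K" using word_map_K x(1) by (auto simp: G_def)
    show "K \<subseteq> closure G" unfolding G_def by (rule orbit_dense[OF x(1)])
    show "\<exists>\<rho>>0. R k F \<rho>" if "finite F" "F \<subseteq> G" for F k
    proof -
      obtain thin n where "from_nat k = (thin :: bool, n :: nat)" by (meson surj_pair)
      then show ?thesis
        using ex_efficient_scale[OF x(2) that(1) that(2)[unfolded G_def], of "1 / Suc n" thin]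
        by (simp add: R_def)
    qed
  qed
  then show ?thesis
  proof (rule typically_mono)
    fix \<mu> :: "'a measure"
    have cover_all: "\<exists>F \<rho>. finite F \<and> F \<subseteq> K \<and> 0 < \<rho> \<and> efficient_cover thin t F \<rho> \<and> E \<subseteq> (\<Union>x\<in>F. ball x \<rho>)"
      if cover: "\<forall>k. \<exists>F \<rho>. finite F \<and> F \<subseteq> K \<and> 0 < \<rho> \<and> R k F \<rho> \<and> E \<subseteq> (\<Union>x\<in>F. ball x \<rho>)"
        and t: "0 < t" for E thin t
    proof -
      obtain n where n: "1 / real (Suc n) < t" using ex_small_reciprocal[OF t] by blast
      from cover[rule_format, of "to_nat (thin, n)"] obtain F \<rho> where F: "finite F" "F \<subseteq> K" "0 < \<rho>"
        "R (to_nat (thin, n)) F \<rho>" "E \<subseteq> (\<Union>x\<in>F. ball x \<rho>)"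
        by (elim exE conjE) (rule that)
      have "efficient_cover thin (1 / Suc n) F \<rho>" using F(4) by (simp add: R_def)
      then have "efficient_cover thin t F \<rho>"
        by (rule efficient_cover_mono[rotated 3]) (use n F(3) in auto)
      then show ?thesis using F(1,2,3,5) by (intro exI[of _ F] exI[of _ \<rho>] conjI)
    qed
    show "\<forall>\<eta>>0. \<exists>E\<in>sets \<mu>. measure \<mu> E > 1 - \<eta> \<and>
       (\<forall>thin. \<forall>t>0. \<exists>F \<rho>. finite F \<and> F \<subseteq> K \<and> 0 < \<rho> \<and>
        efficient_cover thin t F \<rho> \<and> E \<subseteq> (\<Union>x\<in>F. ball x \<rho>))"
      if *: "\<forall>\<eta>>0. \<exists>E\<in>sets \<mu>. measure \<mu> E > 1 - \<eta> \<and>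
       (\<forall>k. \<exists>F \<rho>. finite F \<and> F \<subseteq> K \<and> 0 < \<rho> \<and> R k F \<rho> \<and> E \<subseteq> (\<Union>x\<in>F. ball x \<rho>))"
    proof (intro allI impI)
      fix \<eta> :: real assume "0 < \<eta>"
      from *[rule_format, OF this] obtain E where "E \<in> sets \<mu>" "measure \<mu> E > 1 - \<eta>" and
        "\<forall>k. \<exists>F \<rho>. finite F \<and> F \<subseteq> K \<and> 0 < \<rho> \<and> R k F \<rho> \<and> E \<subseteq> (\<Union>x\<in>F. ball x \<rho>)"
        by (elim bexE conjE) (rule that)
      with cover_all show "\<exists>E\<in>sets \<mu>. measure \<mu> E > 1 - \<eta> \<and>
       (\<forall>thin. \<forall>t>0. \<exists>F \<rho>. finite F \<and> F \<subseteq> K \<and> 0 < \<rho> \<and>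
        efficient_cover thin t F \<rho> \<and> E \<subseteq> (\<Union>x\<in>F. ball x \<rho>))"
        by (intro bexI[of _ E] conjI allI impI)
    qed
  qed
qed

lemma lower_box_dim_ge_smax:
  assumes "E \<noteq> {}" "0 \<le> q"
  shows "ereal (- smax * q) \<le> lower_box_dim K \<pi> q E"
proof -
  obtain c where c: "0 < c" "\<And>x \<rho>. x \<in> K \<Longrightarrow> 0 < \<rho> \<Longrightarrow> \<rho> < 1 \<Longrightarrow> c * \<rho> powr smax \<le> prob (ball x \<rho>)"
    using ex_measure_ball_ge by blast
  have "c powr q * \<rho> powr (smax * q) \<le> prob (ball x \<rho>) powr q"
    if "x \<in> K" "0 < \<rho>" "\<rho> < 1" for x \<rho>
  proof -
    have "c powr q * \<rho> powr (smax * q) = (c * \<rho> powr smax) powr q"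
      using c by (simp add: powr_mult powr_powr)
    also have "\<dots> \<le> prob (ball x \<rho>) powr q"
      using c that assms(2) by (intro powr_mono2) auto
    finally show ?thesis .
  qed
  then show ?thesis
    using lower_box_dim_ge[OF assms(1), of "c powr q" K "smax * q" \<pi> q] c(1) by simp
qed

text \<open>
  A nonpositive power reverses the upper bound for the mass of a ball only if that mass is
  positive, which \<open>ex_measure_ball_ge\<close> ensures for centres in \<open>K\<close>.
\<close>
lemma lower_box_dim_ge_smin:
  assumes "E \<noteq> {}" "q \<le> 0"
  shows "ereal (- smin * q) \<le> lower_box_dim K \<pi> q E"
proof -
  obtain C where C: "0 < C" "\<And>x \<rho>. 0 < \<rho> \<Longrightarrow> \<rho> < 1 \<Longrightarrow> prob (ball x \<rho>) \<le> C * \<rho> powr smin"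
    using ex_measure_ball_le by blast
  obtain c where c: "0 < c" "\<And>x \<rho>. x \<in> K \<Longrightarrow> 0 < \<rho> \<Longrightarrow> \<rho> < 1 \<Longrightarrow> c * \<rho> powr smax \<le> prob (ball x \<rho>)"
    using ex_measure_ball_ge by blast
  have "C powr q * \<rho> powr (smin * q) \<le> prob (ball x \<rho>) powr q"
    if "x \<in> K" "0 < \<rho>" "\<rho> < 1" for x \<rho>
  proof -
    have "0 < c * \<rho> powr smax" using c(1) that by simp
    then have pos: "0 < prob (ball x \<rho>)" using c(2)[OF that] by linarith
    have "C powr q * \<rho> powr (smin * q) = (C * \<rho> powr smin) powr q"
      using C by (simp add: powr_mult powr_powr)
    also have "\<dots> \<le> prob (ball x \<rho>) powr q"
      using C(2) that assms(2) pos by (intro powr_mono2') auto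
    finally show ?thesis .
  qed
  then show ?thesis
    using lower_box_dim_ge[OF assms(1), of "C powr q" K "smin * q" \<pi> q] C(1) by simp
qed

text \<open>
  The number of balls costs an exponent \<open>t'\<close> and the mass tolerance costs \<open>t' * q\<close>, hence the
  choice \<open>t' \<le> t / (1 + q)\<close>.
\<close>
lemma lower_box_dim_le_smax:
  assumes "0 \<le> q"
    and cover: "\<And>t. 0 < t \<Longrightarrow> \<exists>F \<rho>. finite F \<and> F \<subseteq> K \<and> 0 < \<rho> \<and>
        efficient_cover True t F \<rho> \<and> E \<subseteq> (\<Union>x\<in>F. ball x \<rho>)"
  shows "lower_box_dim K \<pi> q E \<le> ereal (- smax * q)"
proof -
  have "lower_box_dim K \<pi> q E \<le> ereal (- (smax * q))"
  proof (rule lower_box_dim_le)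
    fix t \<delta> :: real assume t: "0 < t" "0 < \<delta>"
    define t' where "t' = Min {\<delta>, 1, t / (1 + q)}"
    have "0 < t'" using t assms(1) by (simp add: t'_def)
    from cover[OF this] obtain F \<rho> where F: "finite F" "F \<subseteq> K" "0 < \<rho>"
      "efficient_cover True t' F \<rho>" "E \<subseteq> (\<Union>x\<in>F. ball x \<rho>)"
      by (elim exE conjE) (rule that)
    have t': "t' \<le> \<delta>" "t' \<le> 1" "t' * (1 + q) \<le> t"
      using assms(1) by (auto simp: t'_def min_le_iff_disj pos_le_divide_eq[symmetric])
    have \<rho>: "\<rho> < t'" "card F \<le> \<rho> powr (- t')" "\<And>y. y \<in> F \<Longrightarrow> prob (ball y \<rho>) \<le> \<rho> powr (smax - t')"
      using F(4) by (auto simp: efficient_cover_def)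
    have b: "prob (ball y \<rho>) powr q \<le> (\<rho> powr (smax - t')) powr q" if "y \<in> F" for y
      using \<rho>(3)[OF that] assms(1) by (intro powr_mono2) auto
    have "covering_number K \<pi> q E \<rho> \<le> ennreal (real (card F) * (\<rho> powr (smax - t')) powr q)"
      by (rule covering_number_le[OF F(1,2,5) b])
    also have "\<dots> \<le> ennreal (\<rho> powr (- t') * (\<rho> powr (smax - t')) powr q)"
      using \<rho>(2) by (intro ennreal_leI mult_right_mono) auto
    also have "\<rho> powr (- t') * (\<rho> powr (smax - t')) powr q = \<rho> powr (smax * q - t' * (1 + q))"
      by (simp add: powr_powr algebra_simps flip: powr_add)
    also have "ennreal \<dots> \<le> ennreal (\<rho> powr (smax * q - t))"
      using t' \<rho>(1) F(3) by (intro ennreal_leI powr_mono') auto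
    finally show "\<exists>r. 0 < r \<and> r < \<delta> \<and> covering_number K \<pi> q E r \<le> ennreal (r powr (smax * q - t))"
      using F(3) \<rho>(1) t'(1) by (intro exI[of _ \<rho>]) auto
  qed
  then show ?thesis by simp
qed

lemma lower_box_dim_le_smin:
  assumes "q \<le> 0"
    and cover: "\<And>t. 0 < t \<Longrightarrow> \<exists>F \<rho>. finite F \<and> F \<subseteq> K \<and> 0 < \<rho> \<and>
        efficient_cover False t F \<rho> \<and> E \<subseteq> (\<Union>x\<in>F. ball x \<rho>)"
  shows "lower_box_dim K \<pi> q E \<le> ereal (- smin * q)"
proof -
  have "lower_box_dim K \<pi> q E \<le> ereal (- (smin * q))"
  proof (rule lower_box_dim_le)
    fix t \<delta> :: real assume t: "0 < t" "0 < \<delta>"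
    define t' where "t' = Min {\<delta>, 1, t / (1 - q)}"
    have "0 < t'" using t assms(1) by (simp add: t'_def)
    from cover[OF this] obtain F \<rho> where F: "finite F" "F \<subseteq> K" "0 < \<rho>"
      "efficient_cover False t' F \<rho>" "E \<subseteq> (\<Union>x\<in>F. ball x \<rho>)"
      by (elim exE conjE) (rule that)
    have t': "t' \<le> \<delta>" "t' \<le> 1" "t' * (1 - q) \<le> t"
      using assms(1) by (auto simp: t'_def min_le_iff_disj pos_le_divide_eq[symmetric])
    have \<rho>: "\<rho> < t'" "card F \<le> \<rho> powr (- t')" "\<And>y. y \<in> F \<Longrightarrow> \<rho> powr (smin + t') \<le> prob (ball y \<rho>)"
      using F(4) by (auto simp: efficient_cover_def)
    have b: "prob (ball y \<rho>) powr q \<le> (\<rho> powr (smin + t')) powr q" if "y \<in> F" for y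
      using \<rho>(3)[OF that] assms(1) F(3) by (intro powr_mono2') auto
    have "covering_number K \<pi> q E \<rho> \<le> ennreal (real (card F) * (\<rho> powr (smin + t')) powr q)"
      by (rule covering_number_le[OF F(1,2,5) b])
    also have "\<dots> \<le> ennreal (\<rho> powr (- t') * (\<rho> powr (smin + t')) powr q)"
      using \<rho>(2) by (intro ennreal_leI mult_right_mono) auto
    also have "\<rho> powr (- t') * (\<rho> powr (smin + t')) powr q = \<rho> powr (smin * q - t' * (1 - q))"
      by (simp add: powr_powr algebra_simps flip: powr_add)
    also have "ennreal \<dots> \<le> ennreal (\<rho> powr (smin * q - t))"
      using t' \<rho>(1) F(3) by (intro ennreal_leI powr_mono') auto
    finally show "\<exists>r. 0 < r \<and> r < \<delta> \<and> covering_number K \<pi> q E r \<le> ennreal (r powr (smin * q - t))"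
      using F(3) \<rho>(1) t'(1) by (intro exI[of _ \<rho>]) auto
  qed
  then show ?thesis by simp
qed

lemma typical_box_dims:
  "typically (weak_topology_on K) (\<lambda>\<mu>. \<forall>q::real.
      (q \<ge> 0 \<longrightarrow> small_lower_box_dim K \<pi> q \<mu> = ereal (- smax * q) \<and>
                  big_lower_box_dim K \<pi> q \<mu> = ereal (- smax * q)) \<and>
      (q \<le> 0 \<longrightarrow> small_lower_box_dim K \<pi> q \<mu> = ereal (- smin * q) \<and>
                  big_lower_box_dim K \<pi> q \<mu> = ereal (- smin * q)))"
proof (rule typically_mono[OF typically_efficiently_covered], rule allI)
  fix \<mu> :: "'a measure" and q :: real
  assume cover: "\<forall>\<eta>>0. \<exists>E\<in>sets \<mu>. measure \<mu> E > 1 - \<eta> \<and>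
     (\<forall>thin. \<forall>t>0. \<exists>F \<rho>. finite F \<and> F \<subseteq> K \<and> 0 < \<rho> \<and>
        efficient_cover thin t F \<rho> \<and> E \<subseteq> (\<Union>x\<in>F. ball x \<rho>))"
  have upper: "\<exists>E\<in>sets \<mu>. measure \<mu> E > 1 - \<eta> \<and>
      (0 \<le> q \<longrightarrow> lower_box_dim K \<pi> q E \<le> ereal (- smax * q)) \<and>
      (q \<le> 0 \<longrightarrow> lower_box_dim K \<pi> q E \<le> ereal (- smin * q))" if \<eta>: "0 < \<eta>" for \<eta>
  proof -
    from cover[rule_format, OF \<eta>] obtain E where E: "E \<in> sets \<mu>" "measure \<mu> E > 1 - \<eta>"
      and eff: "\<forall>thin. \<forall>t>0. \<exists>F \<rho>. finite F \<and> F \<subseteq> K \<and> 0 < \<rho> \<and>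
        efficient_cover thin t F \<rho> \<and> E \<subseteq> (\<Union>x\<in>F. ball x \<rho>)"
      by (elim bexE conjE) (rule that)
    show ?thesis
      by (intro bexI[of _ E] conjI impI E lower_box_dim_le_smax lower_box_dim_le_smin)
        (assumption | rule eff[rule_format])+
  qed
  show "(q \<ge> 0 \<longrightarrow> small_lower_box_dim K \<pi> q \<mu> = ereal (- smax * q) \<and>
                  big_lower_box_dim K \<pi> q \<mu> = ereal (- smax * q)) \<and>
      (q \<le> 0 \<longrightarrow> small_lower_box_dim K \<pi> q \<mu> = ereal (- smin * q) \<and>
                  big_lower_box_dim K \<pi> q \<mu> = ereal (- smin * q))"
  proof (intro conjI impI)
    assume q: "0 \<le> q"
    have "\<exists>E\<in>sets \<mu>. measure \<mu> E > 1 - \<eta> \<and> lower_box_dim K \<pi> q E \<le> ereal (- smax * q)"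
      if "0 < \<eta>" for \<eta> using upper[OF that] q by blast
    then show "small_lower_box_dim K \<pi> q \<mu> = ereal (- smax * q)"
      "big_lower_box_dim K \<pi> q \<mu> = ereal (- smax * q)"
      using box_dims_eqI[of "ereal (- smax * q)" K \<pi> q \<mu>] lower_box_dim_ge_smax[OF _ q] by blast+
  next
    assume q: "q \<le> 0"
    have "\<exists>E\<in>sets \<mu>. measure \<mu> E > 1 - \<eta> \<and> lower_box_dim K \<pi> q E \<le> ereal (- smin * q)"
      if "0 < \<eta>" for \<eta> using upper[OF that] q by blast
    then show "small_lower_box_dim K \<pi> q \<mu> = ereal (- smin * q)"
      "big_lower_box_dim K \<pi> q \<mu> = ereal (- smin * q)"
      using box_dims_eqI[of "ereal (- smin * q)" K \<pi> q \<mu>] lower_box_dim_ge_smin[OF _ q] by blast+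
  qed
qed

end

theorem corollary1p5:
  fixes M :: nat
    and S :: "nat \<Rightarrow> real ^ 'd \<Rightarrow> real ^ 'd"
    and r p :: "nat \<Rightarrow> real"
    and K :: "(real ^ 'd) set"
    and \<pi> :: "(real ^ 'd) measure"
    and smin smax :: real
  assumes "M \<ge> 2"
    and "\<And>m. m \<in> {1..M} \<Longrightarrow> contracting_similarity (r m) (S m)"
    and "\<And>m. m \<in> {1..M} \<Longrightarrow> p m > 0"
    and "(\<Sum>m\<in>{1..M}. p m) = 1"
    and "K \<noteq> {}" and "compact K" and "K = (\<Union>m\<in>{1..M}. S m ` K)"
    and "prob_space \<pi>" and "sets \<pi> = sets borel"
    and "\<And>A. A \<in> sets borel \<Longrightarrow>
           measure \<pi> A = (\<Sum>m\<in>{1..M}. p m * measure \<pi> (S m -` A))"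
    and "open_set_condition M S"
  defines "smin \<equiv> Min ((\<lambda>m. ln (p m) / ln (r m)) ` {1..M})"
    and "smax \<equiv> Max ((\<lambda>m. ln (p m) / ln (r m)) ` {1..M})"
  shows "typically (weak_topology_on K) (\<lambda>\<mu>. \<forall>q::real.
      (q \<ge> 0 \<longrightarrow> small_lower_box_dim K \<pi> q \<mu> = ereal (- smax * q) \<and>
                  big_lower_box_dim K \<pi> q \<mu> = ereal (- smax * q)) \<and>
      (q \<le> 0 \<longrightarrow> small_lower_box_dim K \<pi> q \<mu> = ereal (- smin * q) \<and>
                  big_lower_box_dim K \<pi> q \<mu> = ereal (- smin * q)))"
proof -
  interpret ssm: self_similar_measure M S r p K \<pi>
    using assms(2-11) by (rule self_similar_measure.intro)
  show ?thesis
    using ssm.typical_box_dims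
    unfolding smin_def smax_def ssm.smin_def ssm.smax_def .
qed

end
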